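(* Let $A$ be a semisimple complex Banach algebra with identity. The following two assertions are equivalent. (I) For every linear functional $f$ on $\mathrm{Soc}\,A$, the following two conditions on $f$ are equivalent: (a) $f=\alpha\,\mathrm{Tr}$ for some $\alpha\in\mathbb{C}$; (b) $f(ab)=f(ba)$ for all $a,b\in \mathrm{Soc}\,A$. (II) $\mathrm{Soc}\,A$ is a minimal two-sided ideal of $A$.
   Context: $A$ is a semisimple complex Banach algebra with identity $\mathbf 1$. For $x\in A$, $\sigma(x)$ is the spectrum and $\sigma'(x)=\sigma(x)\setminus\{0\}$; $\#K$ denotes the number of elements of a set $K$. The rank of $a\in A$ is $\mathrm{rank}(a)=\sup_{x\in A}\#\sigma'(xa)\in\{0,1,2,\dots\}\cup\{\infty\}$. The socle $\mathrm{Soc}\,A$ is the two-sided ideal of all finite-rank elements of $A$ (it coincides with the usual socle, the sum of all minimal left ideals, and is $\{0\}$ if there are none). For $a\in \mathrm{Soc}\,A$ let $E(a)=\{x\in A:\#\sigma'(xa)=\mathrm{rank}(a)\}$, which is a dense open subset of $A$. For $a\in\mathrm{Soc}\,A$ and $\lambda\in\sigma(a)$, let $B(\lambda,r)$ be an open disk whose closure contains no point of $\sigma(a)$ other than $\lambda$; there is an open ball $U\subseteq A$ centered at $\mathbf 1$ such that $\#[\sigma(xa)\cap B(\lambda,r)]$ is constant for $x\in E(a)\cap U$, and this constant is the multiplicity $m(\lambda,a)$. The trace is $\mathrm{Tr}(a)=\sum_{\lambda\in\sigma(a)}\lambda\, m(\lambda,a)$ for $a\in\mathrm{Soc}\,A$;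 it is a linear functional on $\mathrm{Soc}\,A$. Linear functionals are complex-linear and not assumed continuous. A two-sided ideal $J$ of $A$ is called minimal here if the only two-sided ideals of $A$ contained in $J$ are $\{0\}$ and $J$; in particular $J=\{0\}$ counts as minimal. *)

theory Defs
  imports "HOL-Analysis.Analysis" "HOL-Library.Extended_Nat"
begin

text \<open>
  The norm of the identity is not required to be \<open>1\<close>. The real structure
  inherited from \<^class>\<open>banach\<close> is the restriction of the complex one.
\<close>

class complex_banach_algebra_1 = real_normed_algebra + real_algebra_1 + banach +
  fixes scaleC :: "complex \<Rightarrow> 'a \<Rightarrow> 'a"  (infixr \<open>*\<^sub>C\<close> 75)
  assumes scaleC_add_right: "c *\<^sub>C (x + y) = c *\<^sub>C x + c *\<^sub>C y"
    and scaleC_add_left: "(c + d) *\<^sub>C x = c *\<^sub>C x + d *\<^sub>C x"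
    and scaleC_scaleC: "c *\<^sub>C d *\<^sub>C x = (c * d) *\<^sub>C x"
    and scaleR_scaleC: "r *\<^sub>R x = complex_of_real r *\<^sub>C x"
    and mult_scaleC_left: "c *\<^sub>C x * y = c *\<^sub>C (x * y)"
    and mult_scaleC_right: "x * c *\<^sub>C y = c *\<^sub>C (x * y)"
    and norm_scaleC: "norm (c *\<^sub>C x) = cmod c * norm x"

global_interpretation complex_vector:
  vector_space "scaleC :: complex \<Rightarrow> 'a \<Rightarrow> 'a::complex_banach_algebra_1"
proof
  fix x :: 'a
  show "1 *\<^sub>C x = x"
    using scaleR_scaleC[of 1 x] by simp
qed (simp_all add: scaleC_add_right scaleC_add_left scaleC_scaleC)

definition left_ideal :: "'a::complex_banach_algebra_1 set \<Rightarrow> bool" where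
  "left_ideal I \<longleftrightarrow> complex_vector.subspace I \<and> (\<forall>a. \<forall>x\<in>I. a * x \<in> I)"

definition two_sided_ideal :: "'a::complex_banach_algebra_1 set \<Rightarrow> bool" where
  "two_sided_ideal I \<longleftrightarrow>
     complex_vector.subspace I \<and> (\<forall>a. \<forall>x\<in>I. a * x \<in> I \<and> x * a \<in> I)"

definition maximal_left_ideal :: "'a::complex_banach_algebra_1 set \<Rightarrow> bool" where
  "maximal_left_ideal M \<longleftrightarrow>
     left_ideal M \<and> M \<noteq> UNIV \<and> (\<forall>I. left_ideal I \<and> M \<subseteq> I \<longrightarrow> I = M \<or> I = UNIV)"

text \<open>The zero ideal counts as minimal.\<close>

definition minimal_two_sided_ideal :: "'a::complex_banach_algebra_1 set \<Rightarrow> bool" where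
  "minimal_two_sided_ideal J \<longleftrightarrow>
     two_sided_ideal J \<and> (\<forall>I. two_sided_ideal I \<and> I \<subseteq> J \<longrightarrow> I = {0} \<or> I = J)"

definition jacobson_radical :: "'a::complex_banach_algebra_1 set" where
  "jacobson_radical = \<Inter>{M. maximal_left_ideal M}"

definition semisimple :: "'a::complex_banach_algebra_1 itself \<Rightarrow> bool" where
  "semisimple _ \<longleftrightarrow> (jacobson_radical :: 'a set) = {0}"

definition spectrum :: "'a::complex_banach_algebra_1 \<Rightarrow> complex set" where
  "spectrum x = {\<mu>. \<not> (\<exists>y. (\<mu> *\<^sub>C 1 - x) * y = 1 \<and> y * (\<mu> *\<^sub>C 1 - x) = 1)}"

definition nonzero_spectrum :: "'a::complex_banach_algebra_1 \<Rightarrow> complex set" where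
  "nonzero_spectrum x = spectrum x - {0}"

definition ecard :: "'b set \<Rightarrow> enat" where
  "ecard K = (if finite K then enat (card K) else \<infinity>)"

definition spectral_rank :: "'a::complex_banach_algebra_1 \<Rightarrow> enat" where
  "spectral_rank a = (SUP x. ecard (nonzero_spectrum (x * a)))"

definition Soc :: "'a::complex_banach_algebra_1 set" where
  "Soc = {a. spectral_rank a < \<infinity>}"

definition rank_attaining :: "'a::complex_banach_algebra_1 \<Rightarrow> 'a set" where
  "rank_attaining a = {x. ecard (nonzero_spectrum (x * a)) = spectral_rank a}"

text \<open>
  For \<open>a \<in> Soc\<close> and \<open>\<mu> \<in> spectrum a\<close> an admissible disk exists and the constant
  value depends neither on the disk nor on the neighbourhood of the identity, so
  the description is definite. For other arguments the value is irrelevant.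
\<close>

definition multiplicity_at :: "complex \<Rightarrow> 'a::complex_banach_algebra_1 \<Rightarrow> nat" where
  "multiplicity_at \<mu> a =
     (THE n. \<exists>r>0. cball \<mu> r \<inter> spectrum a = {\<mu>} \<and>
        (\<exists>\<epsilon>>0. \<forall>x \<in> rank_attaining a \<inter> ball 1 \<epsilon>. ecard (spectrum (x * a) \<inter> ball \<mu> r) = enat n))"

definition Tr :: "'a::complex_banach_algebra_1 \<Rightarrow> complex" where
  "Tr a = (\<Sum>\<mu>\<in>spectrum a. \<mu> * of_nat (multiplicity_at \<mu> a))"

text \<open>
  A functional on a subspace \<open>S\<close> is represented by a function on the whole algebra
  whose values outside \<open>S\<close> are ignored.
\<close>

definition linear_functional_on ::
    "'a::complex_banach_algebra_1 set \<Rightarrow> ('a \<Rightarrow> complex) \<Rightarrow> bool" where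
  "linear_functional_on S f \<longleftrightarrow>
     (\<forall>x\<in>S. \<forall>y\<in>S. f (x + y) = f x + f y) \<and> (\<forall>c. \<forall>x\<in>S. f (c *\<^sub>C x) = c * f x)"

end

theory Submission
  imports Defs "HOL-Computational_Algebra.Field_as_Ring" "Subresultants.Subresultant_Gcd"
    "Jordan_Normal_Form.Schur_Decomposition"
begin

text \<open>
  If \<open>a\<close> has finite spectral rank, an interpolation argument with maximal left ideals bounds the
  length of \<open>A a\<close> by the rank and writes \<open>a\<close> as a sum of at most \<open>rank a\<close> elements that generate
  minimal left ideals. By the lemma of Brauer and the Gelfand-Mazur theorem for corners these
  have the form \<open>x p y\<close> with \<open>p A p = \<complex> p\<close>, where \<open>p\<close> runs through a transversal \<open>P\<close> of the minimal
  idempotents up to equivalence. For \<open>a = \<Sum> x\<^sub>i p\<^sub>i y\<^sub>i\<close> the nonzero spectrum of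
  \<open>z a\<close> is that of the scalar matrix of the \<open>p\<^sub>i y\<^sub>i z x\<^sub>j p\<^sub>j\<close>. Hence the spectral multiplicities are
  those of the characteristic polynomial at \<open>z = 1\<close>, and \<open>Tr a\<close> is the matrix trace.

  More generally, every weight \<open>w\<close> on \<open>P\<close> gives a trace on the socle, with value \<open>w p\<close> at \<open>p\<close>.
  All of these are multiples of \<open>Tr\<close> iff \<open>P\<close> has at most one element, iff the socle is minimal.
\<close>

section \<open>Decomposition of finite-rank elements\<close>

text \<open>The obstacle is the definition of the multiplicity: it counts distinct points of spectra
  near the identity, and only at elements that attain the rank. The length bound overcomes it. Any
  decomposition of \<open>a\<close> has at least \<open>rank a\<close> summands, so one with at most
  that many has exactly that many, and the matrix of \<open>z a\<close> has size
  \<open>rank a\<close>. Hence \<open>z\<close> attains the rank iff the characteristic polynomial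
  has only simple nonzero roots. For a larger matrix no \<open>z\<close> would do so, and counting
  points would no longer count roots with multiplicity. On a line joining the identity to an
  attaining element, the exceptional parameters are zeros of one nonzero polynomial built from a
  resultant; so attaining elements occur arbitrarily near the identity.

  Decompositions are far from unique. Independence of the choice is proved by pure algebra, for all
  weights at once; linearity of \<open>Tr\<close> is then a consequence and not an assumption. The
  matrix determines the spectrum only away from 0, which is harmless because 0 contributes nothing
  to the trace.\<close>

lemma left_idealD:
  assumes "left_ideal I"
  shows "0 \<in> I" "x \<in> I \<Longrightarrow> y \<in> I \<Longrightarrow> x + y \<in> I" "x \<in> I \<Longrightarrow> y \<in> I \<Longrightarrow> x - y \<in> I"
    "x \<in> I \<Longrightarrow> a * x \<in> I"
  using assms complex_vector.subspace_0 complex_vector.subspace_add complex_vector.subspace_diff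
  unfolding left_ideal_def by blast+

lemma maximal_left_idealD:
  assumes "maximal_left_ideal L"
  shows "left_ideal L" "1 \<notin> L"
proof -
  show l: "left_ideal L" using assms by (simp add: maximal_left_ideal_def)
  show "1 \<notin> L"
  proof
    assume "1 \<in> L"
    then have "x \<in> L" for x using left_idealD(4)[OF l, of 1 x] by simp
    then show False using assms by (auto simp: maximal_left_ideal_def)
  qed
qed

text \<open>The left ideal \<open>L + A a\<close> properly contains \<open>L\<close>, so it is all
  of \<open>A\<close>: the class of \<open>a\<close> generates the simple module
  \<open>A / L\<close>.\<close>

lemma maximal_left_ideal_solve:
  assumes L: "maximal_left_ideal L" and a: "a \<notin> L"
  obtains y where "y * a - b \<in> L"
proof -
  have l: "left_ideal L" using L by (rule maximal_left_idealD)
  define I where "I = {l + y * a | l y. l \<in> L}"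
  have "left_ideal I"
    unfolding left_ideal_def complex_vector.subspace_def
  proof (intro conjI allI ballI)
    show "0 \<in> I" unfolding I_def using left_idealD(1)[OF l]
      by (intro CollectI exI[of _ 0]) simp
    fix x assume "x \<in> I"
    then obtain l1 y1 where 1: "x = l1 + y1 * a" "l1 \<in> L" by (auto simp: I_def)
    show "c *\<^sub>C x \<in> I" for c
    proof -
      have "c *\<^sub>C x = c *\<^sub>C l1 + (c *\<^sub>C y1) * a"
        by (simp add: 1 scaleC_add_right mult_scaleC_left)
      moreover have "c *\<^sub>C l1 \<in> L" using l 1(2) complex_vector.subspace_scale
        unfolding left_ideal_def by blast
      ultimately show ?thesis unfolding I_def by blast
    qed
    show "b * x \<in> I" for b
    proof -
      have "b * x = b * l1 + (b * y1) * a" by (simp add: 1 algebra_simps)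
      then show ?thesis unfolding I_def using left_idealD(4)[OF l 1(2)] by blast
    qed
    fix z assume "z \<in> I"
    then obtain l2 y2 where 2: "z = l2 + y2 * a" "l2 \<in> L" by (auto simp: I_def)
    have "x + z = (l1 + l2) + (y1 + y2) * a" by (simp add: 1 2 algebra_simps)
    then show "x + z \<in> I" unfolding I_def using left_idealD(2)[OF l 1(2) 2(2)] by blast
  qed
  moreover have "L \<subseteq> I"
  proof
    fix x assume "x \<in> L"
    then show "x \<in> I" unfolding I_def by (intro CollectI exI[of _ x] exI[of _ 0]) simp
  qed
  moreover have "a \<in> I" unfolding I_def using left_idealD(1)[OF l]
    by (intro CollectI exI[of _ 0] exI[of _ 1]) simp
  ultimately have "I = UNIV" using L a unfolding maximal_left_ideal_def by blast
  then have "b \<in> I" by simp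
  then obtain l1 y where "b = l1 + y * a" "l1 \<in> L" by (auto simp: I_def)
  then have "y * a - b = 0 - l1" by simp
  then show ?thesis using that[of y] left_idealD(3)[OF l left_idealD(1)[OF l] \<open>l1 \<in> L\<close>] by simp
qed

text \<open>The class of \<open>1\<close> in \<open>A / L\<close> is nonzero and an eigenvector of
  left multiplication by \<open>x\<close>, so \<open>c 1 - x\<close> cannot have a left
  inverse.\<close>

lemma spectrum_left_ideal:
  assumes L: "maximal_left_ideal L" and x: "x - c *\<^sub>C 1 \<in> L"
  shows "c \<in> spectrum x"
proof (rule ccontr)
  assume "c \<notin> spectrum x"
  then obtain y where "y * (c *\<^sub>C 1 - x) = 1" unfolding spectrum_def by blast
  moreover have "(- y) * (x - c *\<^sub>C 1) \<in> L"
    using left_idealD(4)[OF maximal_left_idealD(1)[OF L] x] .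
  ultimately have "1 \<in> L" by (simp add: algebra_simps)
  then show False using maximal_left_idealD(2)[OF L] by simp
qed

text \<open>
  The modules \<open>A / (L i : a)\<close> are independent simple quotients of the left module \<open>A a\<close>.
\<close>

definition independent_family ::
    "'a::complex_banach_algebra_1 \<Rightarrow> nat \<Rightarrow> (nat \<Rightarrow> 'a set) \<Rightarrow> (nat \<Rightarrow> 'a) \<Rightarrow> bool" where
  "independent_family a k L e \<longleftrightarrow>
     (\<forall>i<k. maximal_left_ideal (L i) \<and> a \<notin> L i \<and> e i * a - a \<in> L i \<and>
        (\<forall>j<k. j \<noteq> i \<longrightarrow> e i * a \<in> L j))"

lemma left_ideal_sum: "left_ideal I \<Longrightarrow> (\<And>i. i \<in> S \<Longrightarrow> f i \<in> I) \<Longrightarrow> sum f S \<in> I"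
  by (induction S rule: infinite_finite_induct) (auto intro: left_idealD)

lemma ecard_mono: "A \<subseteq> B \<Longrightarrow> ecard A \<le> ecard B"
  by (auto simp: ecard_def card_mono finite_subset)

text \<open>Interpolation: \<open>e i\<close> isolates the \<open>i\<close>-th quotient, and
  \<open>y i\<close> carries the class of \<open>a\<close> to that of \<open>1\<close> there. So
  \<open>x * a\<close> acts on the class of \<open>1\<close> modulo \<open>L j\<close> as a
  prescribed scalar.\<close>

lemma independent_family_spectrum:
  assumes "independent_family a k L e"
  obtains x where "(\<lambda>i. of_nat (Suc i)) ` {..<k} \<subseteq> nonzero_spectrum (x * a)"
proof -
  note F = assms[unfolded independent_family_def, rule_format]
  have "\<exists>y. y * a - 1 \<in> L i" if "i < k" for i
    using F[OF that] maximal_left_ideal_solve by blast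
  then obtain y where y: "\<And>i. i < k \<Longrightarrow> y i * a - 1 \<in> L i" by metis
  \<comment> \<open>Any distinct scalars would do; \<open>Suc i\<close> avoids 0, which
    \<open>nonzero_spectrum\<close> discards.\<close>
  define x where "x = (\<Sum>i<k. of_nat (Suc i) *\<^sub>C (y i * e i))"
  have "of_nat (Suc j) \<in> spectrum (x * a)" if j: "j < k" for j
  proof (rule spectrum_left_ideal[of "L j"])
    show "maximal_left_ideal (L j)" using F[OF j] by simp
    then have l: "left_ideal (L j)" by (rule maximal_left_idealD)
    have sc: "c *\<^sub>C z \<in> L j" if "z \<in> L j" for c z
      using l that complex_vector.subspace_scale unfolding left_ideal_def by blast
    have "x * a = (\<Sum>i<k. of_nat (Suc i) *\<^sub>C (y i * (e i * a)))"
      by (simp add: x_def sum_distrib_right mult_scaleC_left mult.assoc)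
    also have "\<dots> = of_nat (Suc j) *\<^sub>C (y j * (e j * a))
        + (\<Sum>i\<in>{..<k}-{j}. of_nat (Suc i) *\<^sub>C (y i * (e i * a)))"
      using j by (subst sum.remove[of _ j]) auto
    also have "\<dots> - of_nat (Suc j) *\<^sub>C 1 = of_nat (Suc j) *\<^sub>C (y j * (e j * a - a))
        + of_nat (Suc j) *\<^sub>C (y j * a - 1)
        + (\<Sum>i\<in>{..<k}-{j}. of_nat (Suc i) *\<^sub>C (y i * (e i * a)))"
      by (simp add: right_diff_distrib complex_vector.scale_right_diff_distrib)
    also have "\<dots> \<in> L j"
    proof (intro left_idealD(2)[OF l] left_ideal_sum[OF l] sc)
      show "y j * (e j * a - a) \<in> L j" using F[OF j] left_idealD(4)[OF l] by blast
      show "y j * a - 1 \<in> L j" using y[OF j] .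
      show "y i * (e i * a) \<in> L j" if "i \<in> {..<k} - {j}" for i
        using F[of i] that j left_idealD(4)[OF l] by blast
    qed
    finally show "x * a - of_nat (Suc j) *\<^sub>C 1 \<in> L j" .
  qed
  moreover have "of_nat (Suc j) \<noteq> (0::complex)" for j by (metis of_nat_eq_0_iff nat.distinct(2))
  ultimately have "(\<lambda>i. of_nat (Suc i)) ` {..<k} \<subseteq> nonzero_spectrum (x * a)"
    unfolding nonzero_spectrum_def image_subset_iff lessThan_iff by simp
  then show ?thesis using that by blast
qed

lemma independent_family_le_rank:
  assumes "independent_family a k L e"
  shows "enat k \<le> spectral_rank a"
proof -
  obtain x where x: "(\<lambda>i. of_nat (Suc i)) ` {..<k} \<subseteq> nonzero_spectrum (x * a)"
    using independent_family_spectrum[OF assms] .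
  have "inj_on (\<lambda>i. of_nat (Suc i) :: complex) {..<k}"
    by (simp add: inj_on_def)
  then have "enat k = ecard ((\<lambda>i. of_nat (Suc i) :: complex) ` {..<k})"
    by (simp add: ecard_def card_image)
  also have "\<dots> \<le> ecard (nonzero_spectrum (x * a))" using x by (rule ecard_mono)
  also have "\<dots> \<le> spectral_rank a" unfolding spectral_rank_def by (rule SUP_upper) simp
  finally show ?thesis .
qed

lemma semisimpleD:
  assumes "semisimple TYPE('a::complex_banach_algebra_1)" "(x::'a) \<noteq> 0"
  obtains L where "maximal_left_ideal L" "x \<notin> L"
  using assms unfolding semisimple_def jacobson_radical_def by blast

text \<open>If \<open>b\<close> is not in \<open>L\<close> and \<open>y * b\<close> is
  \<open>1\<close> modulo \<open>L\<close>, then \<open>b * y * b\<close> is \<open>b\<close> modulo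
  \<open>L\<close>, hence nonzero. Apart from one choice of a maximal left ideal in
  \<open>Soc_decomposition\<close>, semisimplicity is used only in this form.\<close>

lemma semiprime:
  assumes ss: "semisimple TYPE('a::complex_banach_algebra_1)" and b: "(b::'a) \<noteq> 0"
  obtains x where "b * x * b \<noteq> 0"
proof (rule ccontr)
  assume "\<not> thesis"
  with that have z: "b * x * b = 0" for x by blast
  obtain L where L: "maximal_left_ideal L" "b \<notin> L" using semisimpleD[OF ss b] .
  note l = maximal_left_idealD(1)[OF L(1)]
  obtain y where "y * b - 1 \<in> L" using maximal_left_ideal_solve[OF L] .
  then have "(- b) * (y * b - 1) \<in> L" by (rule left_idealD(4)[OF l])
  then show False using z[of y] L(2) by (simp add: algebra_simps)
qed

text \<open>A multiple \<open>f\<close> of \<open>x\<close> fixes \<open>a\<close> modulo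
  \<open>M\<close> and kills it modulo every \<open>L i\<close>, so \<open>f\<close> can serve as
  the new projection. Replacing \<open>e i\<close> by \<open>e i * (1 - f)\<close> removes its
  component at \<open>M\<close> and changes nothing modulo the old ideals.\<close>

lemma independent_family_extend:
  assumes F: "independent_family a k L e"
    and x: "\<forall>i<k. x * a \<in> L i" and M: "maximal_left_ideal M" "x * a \<notin> M"
  obtains L' e' where "independent_family a (Suc k) L' e'"
proof -
  note m = maximal_left_idealD(1)[OF M(1)]
  have aM: "a \<notin> M" using M(2) left_idealD(4)[OF m] by blast
  obtain y where y: "y * (x * a) - a \<in> M" using maximal_left_ideal_solve[OF M] .
  define f where "f = y * x"
  have fM: "f * a - a \<in> M" using y by (simp add: f_def mult.assoc)
  note F = F[unfolded independent_family_def, rule_format]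
  have l: "left_ideal (L i)" if "i < k" for i using F that maximal_left_idealD by blast
  have fL: "f * a \<in> L i" if "i < k" for i
    using left_idealD(4)[OF l[OF that], of "x * a" y] x that by (simp add: f_def mult.assoc)
  define e' where "e' = (\<lambda>i. if i = k then f else e i - e i * f)"
  define L' where "L' = L(k := M)"
  have "independent_family a (Suc k) L' e'"
    unfolding independent_family_def
  proof (intro allI impI)
    fix i assume i: "i < Suc k"
    show "maximal_left_ideal (L' i) \<and> a \<notin> L' i \<and> e' i * a - a \<in> L' i \<and>
        (\<forall>j<Suc k. j \<noteq> i \<longrightarrow> e' i * a \<in> L' j)"
    proof (cases "i = k")
      case True
      then show ?thesis using M aM fM fL by (auto simp: L'_def e'_def)
    next
      case False
      then have ik: "i < k" using i by simp
      have ea: "e' i * a = e i * a - e i * (f * a)" using False by (simp add: e'_def algebra_simps)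
      have "e' i * a - a = (e i * a - a) - e i * (f * a)" by (simp add: ea)
      also have "\<dots> \<in> L i" using F[OF ik] fL[OF ik] left_idealD(3,4)[OF l[OF ik]] by blast
      finally have 1: "e' i * a - a \<in> L i" .
      have 2: "e' i * a \<in> L j" if "j < k" "j \<noteq> i" for j
        unfolding ea using F[OF ik] that fL[OF that(1)] left_idealD(3,4)[OF l[OF that(1)]] by blast
      have "e' i * a = (- e i) * (f * a - a)" unfolding ea by (simp add: algebra_simps)
      also have "\<dots> \<in> M" using left_idealD(4)[OF m fM] .
      finally have 3: "e' i * a \<in> M" .
      show ?thesis using 1 2 3 F[OF ik] ik False by (auto simp: L'_def less_Suc_eq)
    qed
  qed
  then show ?thesis using that by blast
qed

text \<open>The left ideal \<open>A b\<close> is minimal, expressed through generators: it is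
  nonzero and each of its nonzero elements generates it.\<close>

definition simple_left :: "'a::complex_banach_algebra_1 \<Rightarrow> bool" where
  "simple_left b \<longleftrightarrow> b \<noteq> 0 \<and> (\<forall>x. x * b \<noteq> 0 \<longrightarrow> (\<exists>y. y * (x * b) = b))"

text \<open>The rank bounds the length of independent families, so a longest one exists. Its
  maximality embeds \<open>A a\<close> into the product of the simple modules
  \<open>A / L i\<close>, where the \<open>e i\<close> act on \<open>a\<close> as the coordinate
  projections.\<close>

lemma Soc_decomposition:
  assumes ss: "semisimple TYPE('a::complex_banach_algebra_1)" and a: "(a::'a) \<in> Soc"
  obtains k e where "a = (\<Sum>i<k::nat. e i * a)" "enat k \<le> spectral_rank a"
    "\<And>i. i < k \<Longrightarrow> simple_left (e i * a)"
proof -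
  obtain n where n: "spectral_rank a = enat n"
    using a unfolding Soc_def by (cases "spectral_rank a") auto
  let ?P = "\<lambda>k. \<exists>L e. independent_family a k L e"
  have "?P 0" by (simp add: independent_family_def)
  moreover have "\<forall>k. ?P k \<longrightarrow> k \<le> n" using independent_family_le_rank n by force
  ultimately have ex: "?P (GREATEST k. ?P k)" and mx: "\<And>k. ?P k \<Longrightarrow> k \<le> (GREATEST k. ?P k)"
    using GreatestI_nat[of ?P 0 n] Greatest_le_nat[of ?P _ n] by blast+
  define k where "k = (GREATEST k. ?P k)"
  obtain L e where F0: "independent_family a k L e" using ex unfolding k_def by blast
  note F = F0[unfolded independent_family_def, rule_format]
  have l: "left_ideal (L i)" if "i < k" for i using F that maximal_left_idealD by blast
  \<comment> \<open>Injectivity of the embedding: a nonzero \<open>x * a\<close> with all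
    coordinates zero would lengthen the family.\<close>
  have ann: "x * a = 0" if xL: "\<forall>i<k. x * a \<in> L i" for x
  proof (rule ccontr)
    assume "x * a \<noteq> 0"
    then obtain M where "maximal_left_ideal M" "x * a \<notin> M" using semisimpleD[OF ss] by blast
    then obtain L' e' where "independent_family a (Suc k) L' e'"
      using independent_family_extend[OF F0 xL] by blast
    then have "Suc k \<le> k" using mx unfolding k_def by blast
    then show False by simp
  qed
  have "(1 - (\<Sum>i<k. e i)) * a = 0"
  proof (intro ann allI impI)
    fix j assume j: "j < k"
    have "(1 - (\<Sum>i<k. e i)) * a = a - (\<Sum>i<k. e i * a)"
      by (simp add: left_diff_distrib sum_distrib_right)
    also have "\<dots> = 0 - (e j * a - a) - (\<Sum>i\<in>{..<k}-{j}. e i * a)"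
      using j by (subst sum.remove[of _ j]) auto
    also have "\<dots> \<in> L j"
    proof (intro left_idealD(3)[OF l[OF j], of "0 - _"] left_idealD(3)[OF l[OF j], of 0]
        left_ideal_sum[OF l[OF j]] left_idealD(1)[OF l[OF j]])
      show "e j * a - a \<in> L j" using F[OF j] by blast
      show "e i * a \<in> L j" if "i \<in> {..<k} - {j}" for i using F[of i] that j by blast
    qed
    finally show "(1 - (\<Sum>i<k. e i)) * a \<in> L j" .
  qed
  then have 1: "a = (\<Sum>i<k. e i * a)" by (simp add: left_diff_distrib sum_distrib_right)
  \<comment> \<open>Only the \<open>i\<close>-th coordinate of \<open>e i * a\<close> can be
    nonzero, so \<open>A (e i * a)\<close> inherits simplicity from \<open>A / L i\<close>.\<close>
  have 2: "simple_left (e i * a)" if i: "i < k" for i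
    unfolding simple_left_def
  proof (intro conjI allI impI)
    show "e i * a \<noteq> 0"
    proof
      assume "e i * a = 0"
      then have "0 - (e i * a - a) \<in> L i" using F[OF i] left_idealD[OF l[OF i]] by blast
      then show False using \<open>e i * a = 0\<close> F[OF i] by simp
    qed
    fix x assume nz: "x * (e i * a) \<noteq> 0"
    have "x * (e i * a) \<in> L j" if "j < k" "j \<noteq> i" for j
      using F[OF i] left_idealD(4)[OF l[OF that(1)]] that by blast
    then have "x * (e i * a) \<notin> L i" using ann[of "x * e i"] nz
      by (metis mult.assoc)
    then obtain y where y: "y * (x * (e i * a)) - a \<in> L i"
      using maximal_left_ideal_solve F[OF i] by blast
    have "(y * x * e i - e i) * a = 0"
    proof (intro ann allI impI)
      fix j assume j: "j < k"
      show "(y * x * e i - e i) * a \<in> L j"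
      proof (cases "j = i")
        case True
        have "(y * x * e i - e i) * a = (y * (x * (e i * a)) - a) - (e i * a - a)"
          by (simp add: algebra_simps)
        then show ?thesis using True y F[OF i] left_idealD(3)[OF l[OF j]] by metis
      next
        case False
        have "(y * x * e i - e i) * a = (y * x - 1) * (e i * a)" by (simp add: algebra_simps)
        then show ?thesis using False F[OF i] j left_idealD(4)[OF l[OF j]] by metis
      qed
    qed
    then show "\<exists>y. y * (x * (e i * a)) = e i * a"
      by (intro exI[of _ y]) (simp add: algebra_simps)
  qed
  have "enat k \<le> spectral_rank a" using independent_family_le_rank[OF F0] .
  then show ?thesis using that 1 2 by blast
qed

text \<open>Brauer's lemma. Right multiplication by \<open>c\<close> is injective on the simple
  module \<open>A b\<close>, and \<open>e\<close> is an element of \<open>A b\<close> with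
  \<open>e * c = c\<close>. Cancelling \<open>c\<close> in \<open>e * e * c = e * c\<close> and in
  \<open>b * e * c = b * c\<close> gives the two identities; the second lets \<open>b\<close> be
  written through the idempotent.\<close>

lemma simple_left_idempotent:
  assumes ss: "semisimple TYPE('a::complex_banach_algebra_1)" and b: "simple_left (b::'a)"
  obtains e where "simple_left e" "e * e = e" "b * e = b" "\<exists>z. e = z * b"
proof -
  note b0 = b[unfolded simple_left_def]
  obtain x where x: "b * x * b \<noteq> 0" using semiprime[OF ss] b0 by blast
  define c where "c = x * b"
  have "b * x * b = (b * x) * b" by simp
  then obtain y where y: "y * (b * x * b) = b" using x b0 by metis
  define e where "e = x * y * b"
  have ec: "e * c = c" using y by (simp add: e_def c_def mult.assoc)
  have ann: "w * b = 0" if "w * b * c = 0" for w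
  proof (rule ccontr)
    assume "w * b \<noteq> 0"
    then obtain v where "v * (w * b) = b" using b0 by blast
    then have "b * c = v * (w * b * c)" by (simp add: mult.assoc [symmetric])
    then show False using that x by (simp add: c_def mult.assoc)
  qed
  have "(e * x * y - x * y) * b = 0"
    by (rule ann) (use ec in \<open>simp add: algebra_simps e_def\<close>)
  then have ee: "e * e = e" by (simp add: e_def algebra_simps)
  have "(b * x * y - 1) * b = 0"
    by (rule ann) (use ec in \<open>simp add: algebra_simps e_def\<close>)
  then have be: "b * e = b" by (simp add: e_def algebra_simps)
  have "simple_left e"
    unfolding simple_left_def
  proof (intro conjI allI impI)
    show "e \<noteq> 0" using be b0 by auto
    fix w assume "w * e \<noteq> 0"
    then have "(w * x * y) * b \<noteq> 0" by (simp add: e_def mult.assoc)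
    then obtain v where "v * ((w * x * y) * b) = b" using b0 by blast
    then have "(x * y * v) * (w * e) = e" by (simp add: e_def mult.assoc)
    then show "\<exists>v. v * (w * e) = e" by blast
  qed
  then show ?thesis using that ee be e_def by blast
qed

section \<open>The Gelfand-Mazur theorem in a corner\<close>

lemma bounded_bilinear_scaleC:
  "bounded_bilinear (scaleC :: complex \<Rightarrow> 'a::complex_banach_algebra_1 \<Rightarrow> 'a)"
proof
  fix r :: real and a b :: complex and x y :: 'a
  show "(a + b) *\<^sub>C x = a *\<^sub>C x + b *\<^sub>C x" by (rule scaleC_add_left)
  show "a *\<^sub>C (x + y) = a *\<^sub>C x + a *\<^sub>C y" by (rule scaleC_add_right)
  show "(r *\<^sub>R a) *\<^sub>C x = r *\<^sub>R (a *\<^sub>C x)" by (simp add: scaleR_scaleC scaleC_scaleC scaleR_conv_of_real)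
  show "a *\<^sub>C (r *\<^sub>R x) = r *\<^sub>R (a *\<^sub>C x)" by (simp add: scaleR_scaleC scaleC_scaleC mult.commute)
  show "\<exists>K. \<forall>a x. norm (a *\<^sub>C (x::'a)) \<le> norm a * norm x * K"
    by (rule exI[of _ 1]) (simp add: norm_scaleC)
qed

lemmas continuous_on_scaleC = bounded_bilinear.continuous_on[OF bounded_bilinear_scaleC]
  and bounded_linear_scaleC_left = bounded_bilinear.bounded_linear_left[OF bounded_bilinear_scaleC]
  and bounded_linear_scaleC_right = bounded_bilinear.bounded_linear_right[OF bounded_bilinear_scaleC]

text \<open>
  An everywhere defined resolvent \<open>R\<close> in the corner \<open>p A p\<close> satisfies the Cauchy-Riemann equation
  in the coordinates \<open>exp (s + i t)\<close>, so its circle mean \<open>G s\<close> does not depend on \<open>s\<close>. It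
  tends to \<open>2\<pi> R(0)\<close> at \<open>-\<infinity>\<close> and to \<open>0\<close> at \<open>\<infinity>\<close>.
\<close>

lemma corner_resolvent_contradiction:
  fixes p y :: "'a::complex_banach_algebra_1" and R :: "complex \<Rightarrow> 'a"
  assumes p: "p \<noteq> 0" and Rl: "\<And>c. R c * (c *\<^sub>C p - y) = p" and Rr: "\<And>c. (c *\<^sub>C p - y) * R c = p"
    and Rp: "\<And>c. R c * p = R c" and pR: "\<And>c. p * R c = R c"
  shows False
proof -
  have res: "R c - R d = (d - c) *\<^sub>C (R c * R d)" for c d
  proof -
    have "R c - R d = R c * ((d *\<^sub>C p - y) * R d) - (R c * (c *\<^sub>C p - y)) * R d"
      by (simp only: Rl Rr Rp pR)
    also have "\<dots> = R c * (((d *\<^sub>C p - y) - (c *\<^sub>C p - y)) * R d)"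
      by (simp add: algebra_simps)
    also have "(d *\<^sub>C p - y) - (c *\<^sub>C p - y) = (d - c) *\<^sub>C p"
      by (simp add: complex_vector.scale_left_diff_distrib)
    finally show ?thesis by (simp add: mult_scaleC_left mult_scaleC_right pR)
  qed
  have nres: "norm (R c - R d) \<le> cmod (c - d) * (norm (R c) * norm (R d))" for c d
    unfolding res norm_scaleC
    by (subst norm_minus_commute) (intro mult_left_mono norm_mult_ineq norm_ge_zero)
  have cont: "(R \<longlongrightarrow> R d) (at d)" for d
  proof -
    \<comment> \<open>Near \<open>d\<close> the resolvent identity gives
      \<open>norm (R c) \<le> norm (R d) + norm (R c) / 2\<close>, so the unknown
      \<open>norm (R c)\<close> is absorbed.\<close>
    have b: "norm (R c - R d) \<le> cmod (c - d) * (2 * norm (R d) * norm (R d))"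
      if c: "cmod (c - d) * norm (R d) < 1 / 2" for c
    proof -
      have "norm (R c) \<le> norm (R d) + norm (R c - R d)" using norm_triangle_sub[of "R c" "R d"] by simp
      also have "\<dots> \<le> norm (R d) + norm (R c) * (cmod (c - d) * norm (R d))"
        using nres[of c d] by (simp add: mult_ac)
      also have "\<dots> \<le> norm (R d) + norm (R c) * (1 / 2)"
        using c by (intro add_left_mono mult_left_mono) auto
      finally have "norm (R c) \<le> 2 * norm (R d)" by simp
      then show ?thesis
        by (intro order_trans[OF nres] mult_left_mono mult_right_mono) auto
    qed
    have t: "((\<lambda>c. cmod (c - d) * K) \<longlongrightarrow> 0) (at d)" for K
      by (rule tendsto_eq_intros refl | simp)+
    have "\<forall>\<^sub>F c in at d. cmod (c - d) * norm (R d) < 1 / 2"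
      using order_tendstoD(2)[OF t, of "1/2"] by simp
    then have "((\<lambda>c. R c - R d) \<longlongrightarrow> 0) (at d)"
      by (intro Lim_null_comparison[OF _ t]) (auto elim!: eventually_mono intro: b)
    then show ?thesis by (simp add: LIM_zero_iff)
  qed
  have contR: "continuous_on S R" for S
    using cont by (auto intro!: continuous_at_imp_continuous_on simp: isCont_def)
  have der: "(R has_derivative (\<lambda>h. - (h *\<^sub>C (R d * R d)))) (at d)" for d
    unfolding has_derivative_iff_norm
  proof
    show "bounded_linear (\<lambda>h. - (h *\<^sub>C (R d * R d)))"
      by (intro bounded_linear_minus bounded_linear_scaleC_left)
    have "((\<lambda>c. norm ((R c - R d) * R d)) \<longlongrightarrow> norm ((R d - R d) * R d)) (at d)"
      by (intro tendsto_intros cont)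
    moreover have "\<forall>\<^sub>F c in at d. norm ((R c - R d) * R d) =
        norm (R c - R d - - ((c - d) *\<^sub>C (R d * R d))) / norm (c - d)"
      unfolding eventually_at
    proof (intro exI[of _ 1] conjI ballI impI)
      fix c assume c: "c \<noteq> d \<and> dist c d < 1"
      have "R c - R d - - ((c - d) *\<^sub>C (R d * R d)) = (d - c) *\<^sub>C ((R c - R d) * R d)"
        unfolding res[of c d]
        by (metis (no_types, lifting) complex_vector.scale_minus_left complex_vector.scale_right_diff_distrib
            left_diff_distrib minus_diff_eq res)
      then show "norm ((R c - R d) * R d) =
          norm (R c - R d - - ((c - d) *\<^sub>C (R d * R d))) / norm (c - d)"
        using c by (simp add: norm_scaleC norm_minus_commute)
    qed simp
    ultimately show "((\<lambda>c. norm (R c - R d - - ((c - d) *\<^sub>C (R d * R d))) / norm (c - d)) \<longlongrightarrow> 0) (at d)"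
      by (subst (asm) tendsto_cong) auto
  qed
  define z where "z s t = exp (Complex s t)" for s t
  define H where "H s t = R (z s t)" for s t
  define D where "D s t = - (z s t *\<^sub>C (H s t * H s t))" for s t
  have cz: "continuous_on S (\<lambda>x. z (f x) (g x))"
    if "continuous_on S f" "continuous_on S g" for S :: "'x::topological_space set" and f g
    unfolding z_def using that by (intro continuous_intros)
  have cH: "continuous_on S (\<lambda>x. H (f x) (g x))"
    if "continuous_on S f" "continuous_on S g" for S :: "'x::topological_space set" and f g
    unfolding H_def by (rule continuous_on_compose2[OF contR[of UNIV] cz[OF that]]) auto
  have cD: "continuous_on S (\<lambda>x. D (f x) (g x))"
    if "continuous_on S f" "continuous_on S g" for S :: "'x::topological_space set" and f g
    unfolding D_def by (intro continuous_intros continuous_on_scaleC cz cH that)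
  have Hs: "((\<lambda>s. H s t) has_vector_derivative D s t) (at s within U)" for s t U
  proof -
    have "((\<lambda>s. Complex s t) has_vector_derivative 1) (at s within U)"
      unfolding Complex_eq by (auto intro!: derivative_eq_intros)
    from field_vector_diff_chain_within[OF this has_field_derivative_at_within[OF DERIV_exp]]
    have "((\<lambda>s. z s t) has_vector_derivative z s t) (at s within U)"
      by (simp add: z_def o_def)
    from vector_derivative_diff_chain_within[OF this has_derivative_at_withinI[OF der]]
    show ?thesis by (simp add: o_def H_def D_def)
  qed
  have Ht: "((\<lambda>t. H s t) has_vector_derivative \<i> *\<^sub>C D s t) (at t within U)" for s t U
  proof -
    have "((\<lambda>t. Complex s t) has_vector_derivative \<i>) (at t within U)"
      unfolding Complex_eq by (auto intro!: derivative_eq_intros)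
    from field_vector_diff_chain_within[OF this has_field_derivative_at_within[OF DERIV_exp]]
    have "((\<lambda>t. z s t) has_vector_derivative \<i> * z s t) (at t within U)"
      by (simp add: z_def o_def)
    from vector_derivative_diff_chain_within[OF this has_derivative_at_withinI[OF der]]
    show ?thesis by (simp add: o_def H_def D_def scaleC_scaleC)
  qed
  define G where "G s = integral (cbox 0 (2 * pi)) (H s)" for s
  have per: "z s (2 * pi) = z s 0" for s
    unfolding z_def Complex_eq by (simp add: exp_add mult.commute)
  have G': "(G has_vector_derivative 0) (at s within UNIV)" for s
  proof -
    have "((\<lambda>t. \<i> *\<^sub>C D s t) has_integral H s (2 * pi) - H s 0) {0..2 * pi}"
      by (intro fundamental_theorem_of_calculus Ht) simp
    then have "((\<lambda>t. \<i> *\<^sub>C D s t) has_integral 0) {0..2 * pi}"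
      by (simp add: H_def per)
    from has_integral_linear[OF this bounded_linear_scaleC_right[of "- \<i>"]]
    have "(D s has_integral 0) (cbox 0 (2 * pi))"
      by (simp add: o_def scaleC_scaleC)
    then have *: "integral (cbox 0 (2 * pi)) (D s) = 0" by (rule integral_unique)
    show ?thesis
      unfolding G_def *[symmetric]
    proof (rule leibniz_rule_vector_derivative[OF Hs])
      show "H x integrable_on cbox 0 (2 * pi)" for x
        by (intro integrable_continuous cH continuous_intros)
      show "continuous_on (UNIV \<times> cbox 0 (2 * pi)) (\<lambda>(x, t). D x t)"
        unfolding case_prod_unfold by (intro cD continuous_intros)
    qed auto
  qed
  have "\<exists>c. \<forall>s\<in>UNIV. G s = c"
    using has_vector_derivative_zero_constant[of UNIV G] G' by blast
  then obtain C where C: "\<And>s. G s = C" by blast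
  have C_bound: "norm (C - (2 * pi) *\<^sub>R K) \<le> \<epsilon> * (2 * pi)"
    if "\<And>t. norm (H s t - K) \<le> \<epsilon>" for s K \<epsilon>
  proof -
    have int: "H s integrable_on {0..2 * pi}"
      by (intro integrable_continuous_real cH continuous_intros)
    have "C - (2 * pi) *\<^sub>R K = integral {0..2 * pi} (\<lambda>t. H s t - K)"
      using C[of s] by (subst integral_diff[OF int integrable_const_ivl]) (simp add: G_def)
    also have "norm \<dots> \<le> \<epsilon> * (2 * pi - 0)"
      by (intro integral_bound that cH continuous_intros) auto
    finally show ?thesis by simp
  qed
  have small: "(2 * pi) *\<^sub>R K = C"
    if "\<And>\<epsilon>. \<epsilon> > 0 \<Longrightarrow> \<exists>s. \<forall>t. norm (H s t - K) \<le> \<epsilon>" for K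
  proof (rule ccontr)
    assume "(2 * pi) *\<^sub>R K \<noteq> C"
    then have pos: "norm (C - (2 * pi) *\<^sub>R K) > 0" by simp
    obtain s where "\<forall>t. norm (H s t - K) \<le> norm (C - (2 * pi) *\<^sub>R K) / (4 * pi)"
      using \<open>\<And>\<epsilon>. \<epsilon> > 0 \<Longrightarrow> \<exists>s. \<forall>t. norm (H s t - K) \<le> \<epsilon>\<close>[of "norm (C - (2 * pi) *\<^sub>R K) / (4 * pi)"]
        pos by auto
    then have "norm (C - (2 * pi) *\<^sub>R K) \<le> norm (C - (2 * pi) *\<^sub>R K) / (4 * pi) * (2 * pi)"
      by (intro C_bound[of s]) simp
    then show False using pos by simp
  qed
  have nz: "cmod (z s t) = exp s" for s t by (simp add: z_def)
  have "(2 * pi) *\<^sub>R R 0 = C"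
  proof (rule small)
    fix \<epsilon> :: real assume "\<epsilon> > 0"
    with cont[of 0] obtain d where d: "d > 0" "\<And>c. c \<noteq> 0 \<Longrightarrow> cmod c < d \<Longrightarrow> norm (R c - R 0) < \<epsilon>"
      unfolding LIM_def by (auto simp: dist_norm)
    show "\<exists>s. \<forall>t. norm (H s t - R 0) \<le> \<epsilon>"
      unfolding H_def
      by (rule exI[of _ "ln (d / 2)"]) (use d nz[of "ln (d / 2)"] in \<open>auto intro!: less_imp_le d(2) simp: z_def\<close>)
  qed
  moreover have "(2 * pi) *\<^sub>R 0 = C"
  proof (rule small)
    fix \<epsilon> :: real assume e: "\<epsilon> > 0"
    \<comment> \<open>At this radius the term \<open>norm y * norm (H s t)\<close> in the estimate
      below cancels, leaving \<open>norm p / \<epsilon> * norm (H s t) \<le> norm p\<close>.\<close>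
    define s where "s = ln (norm y + norm p / \<epsilon>)"
    have pos: "norm p / \<epsilon> > 0" using e p by simp
    then have s: "exp s = norm y + norm p / \<epsilon>" unfolding s_def by (simp add: add_nonneg_pos)
    have "norm (H s t) \<le> \<epsilon>" for t
    proof -
      have "z s t *\<^sub>C R (z s t) = p + y * R (z s t)"
        using Rr[of "z s t"] by (simp add: algebra_simps mult_scaleC_left pR)
      then have "exp s * norm (H s t) = norm (p + y * H s t)"
        by (metis H_def norm_scaleC nz)
      also have "\<dots> \<le> norm p + norm y * norm (H s t)"
        by (intro norm_triangle_le add_left_mono norm_mult_ineq)
      finally have "norm p / \<epsilon> * norm (H s t) \<le> norm p" by (simp add: s algebra_simps)
      then show ?thesis using e p by (simp add: field_simps)
    qed
    then show "\<exists>s. \<forall>t. norm (H s t - 0) \<le> \<epsilon>" by auto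
  qed
  ultimately have "R 0 = 0" by (metis pi_neq_zero scaleR_eq_0_iff scaleR_zero_right mult_eq_0_iff zero_neq_numeral)
  then show False using Rl[of 0] p by simp
qed

text \<open>If \<open>p * x * p\<close> were not a multiple of \<open>p\<close>, all
  \<open>c p - p * x * p\<close> would be nonzero, hence left invertible in the corner. The left
  inverse is nonzero and so has a left inverse as well, which makes it two-sided; this yields a
  resolvent defined everywhere.\<close>

lemma corner_scalar:
  fixes p :: "'a::complex_banach_algebra_1"
  assumes p: "p \<noteq> 0" "p * p = p"
    and inv: "\<And>x. p * x * p \<noteq> 0 \<Longrightarrow> \<exists>v. v * (p * x * p) = p"
  obtains c where "p * x * p = c *\<^sub>C p"
proof (rule ccontr)
  assume "\<not> thesis"
  with that have ns: "p * x * p \<noteq> c *\<^sub>C p" for c by blast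
  define y where "y = p * x * p"
  have py: "p * y = y" "y * p = y" using p by (simp_all add: y_def mult.assoc) (simp add: p flip: mult.assoc)
  have ex: "\<exists>r. r * (c *\<^sub>C p - y) = p \<and> (c *\<^sub>C p - y) * r = p \<and> r * p = r \<and> p * r = r" for c
  proof -
    define u where "u = c *\<^sub>C p - y"
    have u: "p * u = u" "u * p = u" by (simp_all add: u_def algebra_simps mult_scaleC_left mult_scaleC_right p py)
    then have pup: "p * u * p = u" by simp
    have "u \<noteq> 0" using ns[of c] by (auto simp: u_def y_def)
    then obtain v where v: "v * u = p" using inv[of u] pup by auto
    define r where "r = p * v * p"
    have ru: "r * u = p" by (simp add: r_def mult.assoc u v p)
    have r: "p * r = r" "r * p = r" using p by (simp_all add: r_def mult.assoc) (simp add: p flip: mult.assoc)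
    have "p * r * p = r" using r by simp
    moreover have "r \<noteq> 0" using ru p by auto
    ultimately obtain w where w: "w * r = p" using inv[of r] by auto
    have "u * r = (w * r) * u * r" by (simp add: w u)
    also have "\<dots> = w * (r * u) * r" by (simp add: mult.assoc)
    also have "\<dots> = p" by (simp add: ru r w mult.assoc)
    finally show ?thesis using ru r unfolding u_def by blast
  qed
  then obtain R where R: "\<And>c. R c * (c *\<^sub>C p - y) = p \<and> (c *\<^sub>C p - y) * R c = p \<and> R c * p = R c \<and> p * R c = R c"
    by metis
  show False by (rule corner_resolvent_contradiction[of p R y]) (use p R in auto)
qed

section \<open>Characteristic polynomials\<close>

lemma mat_trace_comm:
  fixes A B :: "'a::comm_semiring_0 mat"
  assumes "A \<in> carrier_mat n n" "B \<in> carrier_mat n n"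
  shows "(\<Sum>i<n. (A * B) $$ (i,i)) = (\<Sum>i<n. (B * A) $$ (i,i))"
proof -
  have "(\<Sum>i<n. (A * B) $$ (i,i)) = (\<Sum>i<n. \<Sum>j<n. A $$ (i,j) * B $$ (j,i))"
    using assms by (intro sum.cong refl) (auto simp: scalar_prod_def atLeast0LessThan)
  also have "\<dots> = (\<Sum>j<n. \<Sum>i<n. B $$ (j,i) * A $$ (i,j))"
    by (subst sum.swap) (simp add: mult.commute)
  also have "\<dots> = (\<Sum>i<n. (B * A) $$ (i,i))"
    using assms by (intro sum.cong refl) (auto simp: scalar_prod_def atLeast0LessThan)
  finally show ?thesis .
qed

lemma mat_trace_eigenvalues:
  fixes A :: "complex mat"
  assumes A: "A \<in> carrier_mat n n" and cp: "char_poly A = (\<Prod>a\<leftarrow>es. [:- a, 1:])"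
  shows "(\<Sum>i<n. A $$ (i,i)) = sum_list es"
proof -
  obtain B P Q where "schur_decomposition A es = (B, P, Q)"
    by (cases "schur_decomposition A es") auto
  from schur_decomposition[OF A cp this] have w: "similar_mat_wit A B P Q" and d: "diag_mat B = es"
    by auto
  from similar_mat_witD2[OF A w] have m: "B \<in> carrier_mat n n" "P \<in> carrier_mat n n" "Q \<in> carrier_mat n n"
    and QP: "Q * P = 1\<^sub>m n" and APBQ: "A = P * B * Q" by auto
  have "(\<Sum>i<n. A $$ (i,i)) = (\<Sum>i<n. (Q * (P * B)) $$ (i,i))"
    unfolding APBQ using m by (intro mat_trace_comm) auto
  also have "Q * (P * B) = B" using m QP by (simp flip: assoc_mult_mat)
  also have "(\<Sum>i<n. B $$ (i,i)) = sum_list (diag_mat B)"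
    using m by (simp add: diag_mat_def sum_list_sum_nth atLeast0LessThan)
  finally show ?thesis using d by simp
qed

lemma tendsto_det:
  fixes M :: "'b \<Rightarrow> 'c::{real_normed_field} mat"
  assumes "\<And>x. M x \<in> carrier_mat k k" "N \<in> carrier_mat k k"
    and "\<And>i j. i < k \<Longrightarrow> j < k \<Longrightarrow> ((\<lambda>x. M x $$ (i,j)) \<longlongrightarrow> N $$ (i,j)) F"
  shows "((\<lambda>x. Determinant.det (M x)) \<longlongrightarrow> Determinant.det N) F"
  unfolding det_def'[OF assms(1)] det_def'[OF assms(2)]
proof (intro tendsto_intros assms(3))
  fix p i assume "p \<in> {p. p permutes {0..<k}}" "i \<in> {0..<k}"
  then show "i < k" "p i < k" using permutes_in_image[of p "{0..<k}" i] by auto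
qed

lemma tendsto_poly_char_poly:
  fixes M :: "'b \<Rightarrow> complex mat"
  assumes M: "\<And>x. M x \<in> carrier_mat k k" and N: "N \<in> carrier_mat k k"
    and lim: "\<And>i j. i < k \<Longrightarrow> j < k \<Longrightarrow> ((\<lambda>x. M x $$ (i,j)) \<longlongrightarrow> N $$ (i,j)) F"
  shows "((\<lambda>x. poly (char_poly (M x)) z) \<longlongrightarrow> poly (char_poly N) z) F"
  unfolding char_poly_matrix[OF M] char_poly_matrix[OF N]
proof (rule tendsto_det)
  show "- char_matrix (M x) z \<in> carrier_mat k k" for x using M[of x] by (simp add: char_matrix_def)
  show "- char_matrix N z \<in> carrier_mat k k" using N by (simp add: char_matrix_def)
  fix i j assume ij: "i < k" "j < k"
  have e: "(- char_matrix A z) $$ (i,j) = (if i = j then z else 0) - A $$ (i,j)" if "A \<in> carrier_mat k k" for A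
    using that ij by (auto simp: char_matrix_def)
  show "((\<lambda>x. (- char_matrix (M x) z) $$ (i,j)) \<longlongrightarrow> (- char_matrix N z) $$ (i,j)) F"
    unfolding e[OF M] e[OF N] by (intro tendsto_intros lim ij)
qed

section \<open>Limits of roots, and parameters with simple roots\<close>

lemma simultaneous_convergent_subsequence:
  fixes \<mu> :: "nat \<Rightarrow> nat \<Rightarrow> 'a::heine_borel"
  assumes "\<And>i. i < k \<Longrightarrow> bounded (range (\<lambda>n. \<mu> n i))"
  obtains \<nu> and r :: "nat \<Rightarrow> nat" where "strict_mono r" "\<And>i. i < k \<Longrightarrow> (\<lambda>n. \<mu> (r n) i) \<longlonglongrightarrow> \<nu> i"
  using assms
proof (induction k arbitrary: thesis)
  case 0
  show ?case by (rule 0(1)[of id]) (auto simp: strict_mono_def)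
next
  case (Suc k)
  obtain \<nu> and r :: "nat \<Rightarrow> nat" where r: "strict_mono r" "\<And>i. i < k \<Longrightarrow> (\<lambda>n. \<mu> (r n) i) \<longlonglongrightarrow> \<nu> i"
    using Suc.IH Suc.prems(2) by (metis less_Suc_eq)
  have "bounded (range (\<lambda>n. \<mu> (r n) k))"
    by (rule bounded_subset[OF Suc.prems(2)[of k]]) auto
  then obtain l r' where r': "strict_mono (r' :: nat \<Rightarrow> nat)" "((\<lambda>n. \<mu> (r n) k) \<circ> r') \<longlonglongrightarrow> l"
    using bounded_imp_convergent_subsequence by blast
  show ?case
  proof (rule Suc.prems(1)[of "r \<circ> r'" "\<nu>(k := l)"])
    show "strict_mono (r \<circ> r')" using r(1) r'(1) by (rule strict_mono_o)
    fix i assume "i < Suc k"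
    then show "(\<lambda>n. \<mu> ((r \<circ> r') n) i) \<longlonglongrightarrow> (\<nu>(k := l)) i"
      using r'(2) LIMSEQ_subseq_LIMSEQ[OF r(2) r'(1)] by (cases "i = k") (auto simp: o_def)
  qed
qed

lemma order_prod_linear:
  fixes \<nu> :: "nat \<Rightarrow> 'a::idom"
  shows "Polynomial.order a (\<Prod>i<k. [:- \<nu> i, 1:]) = card {i. i < k \<and> \<nu> i = a}"
proof (induction k)
  case 0
  show ?case by (simp add: order_0I)
next
  case (Suc k)
  have "{i. i < Suc k \<and> \<nu> i = a} = (if \<nu> k = a then insert k {i. i < k \<and> \<nu> i = a} else {i. i < k \<and> \<nu> i = a})"
    by (auto simp: less_Suc_eq)
  moreover have "Polynomial.order a [:- \<nu> k, 1:] = (if \<nu> k = a then 1 else 0)"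
    using order_power_n_n[of a 1] by (auto intro: order_0I)
  moreover have "(\<Prod>i<k. [:- \<nu> i, 1:]) * [:- \<nu> k, 1:] \<noteq> 0"
    by (simp only: mult_eq_0_iff prod_zero_iff finite_lessThan) simp
  ultimately show ?case using Suc by (simp add: order_mult del: mult_pCons_right)
qed

lemma char_poly_roots:
  fixes A :: "complex mat"
  assumes "A \<in> carrier_mat k k"
  obtains \<beta> where "char_poly A = (\<Prod>i<k. [:- \<beta> i, 1:])" "(\<Sum>i<k. A $$ (i,i)) = (\<Sum>i<k. \<beta> i)"
proof -
  obtain es where es: "char_poly A = (\<Prod>a\<leftarrow>es. [:- a, 1:])" "length es = k"
    using char_poly_factorized[OF assms] by blast
  have "char_poly A = (\<Prod>i<k. [:- es ! i, 1:])"
    using es by (simp add: prod.list_conv_set_nth atLeast0LessThan)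
  moreover have "(\<Sum>i<k. A $$ (i,i)) = (\<Sum>i<k. es ! i)"
    using mat_trace_eigenvalues[OF assms es(1)] es(2) by (simp add: sum_list_sum_nth atLeast0LessThan)
  ultimately show ?thesis using that by blast
qed

lemma roots_prod_linear:
  fixes \<beta> :: "nat \<Rightarrow> 'a::idom"
  shows "{z. poly (\<Prod>i<k. [:- \<beta> i, 1:]) z = 0} = \<beta> ` {..<k}"
  by (auto simp: poly_prod)

text \<open>\<open>S\<close> will be a spectrum, which is known to agree with the roots only away
  from 0. Extra points have order 0 and the root 0 has value 0, so neither affects the sum.\<close>

lemma sum_order_eq_trace:
  fixes A :: "complex mat"
  assumes A: "A \<in> carrier_mat k k" and S: "finite S" "{z. poly (char_poly A) z = 0} - {0} \<subseteq> S"
  shows "(\<Sum>z\<in>S. z * of_nat (Polynomial.order z (char_poly A))) = (\<Sum>i<k. A $$ (i,i))"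
proof -
  obtain \<beta> where b: "char_poly A = (\<Prod>i<k. [:- \<beta> i, 1:])" "(\<Sum>i<k. A $$ (i,i)) = (\<Sum>i<k. \<beta> i)"
    using char_poly_roots[OF A] .
  have S': "\<beta> ` {..<k} - {0} \<subseteq> S" using S(2) unfolding b(1) roots_prod_linear .
  have "(\<Sum>z\<in>S. z * of_nat (Polynomial.order z (char_poly A))) = (\<Sum>z\<in>S. \<Sum>i\<in>{i. i < k \<and> \<beta> i = z}. \<beta> i)"
    unfolding b(1) order_prod_linear by (intro sum.cong refl) simp
  also have "\<dots> = (\<Sum>z\<in>S \<union> {0}. \<Sum>i\<in>{i. i < k \<and> \<beta> i = z}. \<beta> i)"
    using S(1) by (intro sum.mono_neutral_left) auto
  also have "\<dots> = (\<Sum>i<k. \<beta> i)"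
    using sum.group[of "{..<k}" "S \<union> {0}" \<beta> \<beta>] S(1) S' by fastforce
  finally show ?thesis using b(2) by simp
qed

text \<open>Enumerations of the roots of \<open>M n\<close> have a convergent subsequence, and the
  limits enumerate the roots of \<open>N\<close> with multiplicity. For a late index exactly those
  roots lie in the disk whose limit is \<open>a\<close>, and they are distinct. A single index is
  enough for the argument by contradiction in \<open>multiplicity_at_val\<close>.\<close>

lemma char_poly_root_count_limit:
  fixes M :: "nat \<Rightarrow> complex mat"
  assumes M: "\<And>n. M n \<in> carrier_mat k k" and N: "N \<in> carrier_mat k k"
    and lim: "\<And>i j. i < k \<Longrightarrow> j < k \<Longrightarrow> (\<lambda>n. M n $$ (i,j)) \<longlonglongrightarrow> N $$ (i,j)"
    and bd: "\<And>n z. poly (char_poly (M n)) z = 0 \<Longrightarrow> cmod z \<le> B"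
    and simple: "\<And>n. card {z. poly (char_poly (M n)) z = 0} = k"
    and iso: "\<And>z. poly (char_poly N) z = 0 \<Longrightarrow> z \<in> cball a r \<Longrightarrow> z = a" and r: "r > 0"
  shows "\<exists>n. card {z. poly (char_poly (M n)) z = 0 \<and> z \<in> ball a r} = Polynomial.order a (char_poly N)"
proof -
  have "\<exists>\<beta>. char_poly (M n) = (\<Prod>i<k. [:- \<beta> i, 1:])" for n
    using char_poly_roots[OF M] by metis
  then obtain \<mu> where \<mu>: "\<And>n. char_poly (M n) = (\<Prod>i<k. [:- \<mu> n i, 1:])" by metis
  have "bounded (range (\<lambda>n. \<mu> n i))" if "i < k" for i
    unfolding bounded_iff using bd that by (intro exI[of _ B]) (auto simp: \<mu> poly_prod)
  then obtain \<nu> s where s: "strict_mono (s :: nat \<Rightarrow> nat)" "\<And>i. i < k \<Longrightarrow> (\<lambda>n. \<mu> (s n) i) \<longlonglongrightarrow> \<nu> i"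
    using simultaneous_convergent_subsequence[of k \<mu>] by metis
  have "poly (char_poly N) z = poly (\<Prod>i<k. [:- \<nu> i, 1:]) z" for z
  proof (rule LIMSEQ_unique)
    have "(\<lambda>n. poly (char_poly (M n)) z) \<longlonglongrightarrow> poly (char_poly N) z"
      by (rule tendsto_poly_char_poly[OF M N lim])
    from LIMSEQ_subseq_LIMSEQ[OF this s(1)]
    show "(\<lambda>n. poly (char_poly (M (s n))) z) \<longlonglongrightarrow> poly (char_poly N) z" by (simp add: o_def)
    show "(\<lambda>n. poly (char_poly (M (s n))) z) \<longlonglongrightarrow> poly (\<Prod>i<k. [:- \<nu> i, 1:]) z"
      unfolding \<mu> poly_prod by (intro tendsto_prod) (auto intro!: tendsto_intros s)
  qed
  then have cN: "char_poly N = (\<Prod>i<k. [:- \<nu> i, 1:])" by (simp add: poly_eq_poly_eq_iff fun_eq_iff flip: poly_eq_poly_eq_iff)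
  have "\<forall>\<^sub>F n in sequentially. (\<mu> (s n) i \<in> ball a r) = (\<nu> i = a)" if i: "i < k" for i
  proof (cases "\<nu> i = a")
    case True
    then show ?thesis using topological_tendstoD[OF s(2)[OF i], of "ball a r"] r by simp
  next
    case False
    \<comment> \<open>Isolation in the closed disk puts the other limits into an open set, so nearby
      roots stay outside too.\<close>
    then have "\<nu> i \<in> - cball a r" using iso[of "\<nu> i"] i by (auto simp: cN poly_prod)
    then have "\<forall>\<^sub>F n in sequentially. \<mu> (s n) i \<in> - cball a r"
      by (intro topological_tendstoD[OF s(2)[OF i]]) auto
    then show ?thesis by eventually_elim (use False in auto)
  qed
  then have "\<forall>\<^sub>F n in sequentially. \<forall>i\<in>{..<k}. (\<mu> (s n) i \<in> ball a r) = (\<nu> i = a)"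
    by (intro eventually_ball_finite) auto
  then obtain n where n: "\<And>i. i < k \<Longrightarrow> (\<mu> (s n) i \<in> ball a r) = (\<nu> i = a)"
    unfolding eventually_sequentially by blast
  have rt: "{z. poly (char_poly (M (s n))) z = 0} = \<mu> (s n) ` {..<k}" unfolding \<mu> by (rule roots_prod_linear)
  then have inj: "inj_on (\<mu> (s n)) {..<k}" using simple[of "s n"] by (intro eq_card_imp_inj_on) auto
  have "{z. poly (char_poly (M (s n))) z = 0 \<and> z \<in> ball a r} = \<mu> (s n) ` {i. i < k \<and> \<nu> i = a}"
    using rt n by fastforce
  then have "card {z. poly (char_poly (M (s n))) z = 0 \<and> z \<in> ball a r} = card {i. i < k \<and> \<nu> i = a}"
    using inj by (auto intro!: card_image inj_on_subset[OF inj])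
  then show ?thesis unfolding cN order_prod_linear by blast
qed

text \<open>Both sides say that \<open>p\<close> and its derivative have no common root. The
  right-hand side is polynomial in the coefficients, as needed for a parameter argument.\<close>

lemma simple_roots_iff_resultant:
  fixes p :: "complex poly"
  assumes "p \<noteq> 0"
  shows "card {z. poly p z = 0} = degree p \<longleftrightarrow> resultant p (pderiv p) \<noteq> 0"
proof -
  have "resultant p (pderiv p) = 0 \<longleftrightarrow> degree (gcd p (pderiv p)) \<noteq> 0" by (rule resultant_0_gcd)
  also have "\<dots> \<longleftrightarrow> (\<exists>a. poly p a = 0 \<and> poly (pderiv p) a = 0)"
  proof
    assume "degree (gcd p (pderiv p)) \<noteq> 0"
    then obtain a where "poly (gcd p (pderiv p)) a = 0"
      using fundamental_theorem_of_algebra[of "gcd p (pderiv p)"] by (auto simp: constant_degree)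
    then show "\<exists>a. poly p a = 0 \<and> poly (pderiv p) a = 0"
      by (meson dvd_trans gcd_dvd1 gcd_dvd2 poly_eq_0_iff_dvd)
  next
    assume "\<exists>a. poly p a = 0 \<and> poly (pderiv p) a = 0"
    then obtain a where "[:- a, 1:] dvd gcd p (pderiv p)" by (auto simp: poly_eq_0_iff_dvd)
    from dvd_imp_degree_le[OF this] show "degree (gcd p (pderiv p)) \<noteq> 0" using assms by simp
  qed
  finally show ?thesis
    using rsquarefree_card_degree[OF assms] unfolding rsquarefree_roots by auto
qed

text \<open>Over the ring of polynomials in \<open>t\<close> the family is one matrix, with
  characteristic polynomial \<open>Q\<close>. The bad parameters are the zeros of a polynomial
  \<open>W\<close> that does not vanish at \<open>s\<close>.\<close>

lemma finite_nonsimple_parameters: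
  fixes A D :: "nat \<Rightarrow> nat \<Rightarrow> complex" and k :: nat
  defines "M \<equiv> \<lambda>t. mat k k (\<lambda>(i,j). A i j + t * D i j)"
  assumes s: "card ({z. poly (char_poly (M s)) z = 0} - {0}) = k"
  shows "finite {t. card ({z. poly (char_poly (M t)) z = 0} - {0}) \<noteq> k}"
proof -
  define Q where "Q = char_poly (mat k k (\<lambda>(i,j). [:A i j, D i j:]))"
  have Q: "degree Q = k" "coeff Q k = 1" using degree_monic_char_poly[of "mat k k (\<lambda>(i,j). [:A i j, D i j:])" k] by (auto simp: Q_def)
  have M: "M t \<in> carrier_mat k k" for t by (simp add: M_def)
  have cp: "char_poly (M t) = map_poly (\<lambda>p. poly p t) Q" for t
  proof -
    have "M t = map_mat (\<lambda>p. poly p t) (mat k k (\<lambda>(i,j). [:A i j, D i j:]))"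
      by (rule eq_matI) (auto simp: M_def)
    then show ?thesis unfolding Q_def by (simp add: poly_hom.char_poly_hom[of _ k])
  qed
  \<comment> \<open>The resultant detects multiple roots, the constant coefficient the root
    0.\<close>
  define W where "W = resultant Q (pderiv Q) * coeff Q 0"
  have key: "card ({z. poly (char_poly (M t)) z = 0} - {0}) = k \<longleftrightarrow> poly W t \<noteq> 0" for t
  proof -
    let ?c = "char_poly (M t)"
    have dc: "degree ?c = k" "?c \<noteq> 0" using degree_monic_char_poly[OF M[of t]] by auto
    have fin: "finite {z. poly ?c z = 0}" using dc(2) by (rule poly_roots_finite)
    have le: "card {z. poly ?c z = 0} \<le> k" using poly_roots_degree[OF dc(2)] dc(1) by simp
    have "card ({z. poly ?c z = 0} - {0}) = k \<longleftrightarrow> card {z. poly ?c z = 0} = degree ?c \<and> poly ?c 0 \<noteq> 0"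
    proof (cases "poly ?c 0 = 0")
      case True
      then have "card ({z. poly ?c z = 0} - {0}) < card {z. poly ?c z = 0}"
        using fin by (intro psubset_card_mono) auto
      then show ?thesis using True le by auto
    next
      case False
      then have "{z. poly ?c z = 0} - {0} = {z. poly ?c z = 0}" by auto
      then show ?thesis using False dc by simp
    qed
    also have "\<dots> \<longleftrightarrow> resultant ?c (pderiv ?c) \<noteq> 0 \<and> poly ?c 0 \<noteq> 0"
      by (simp only: simple_roots_iff_resultant[OF dc(2)])
    also have "pderiv ?c = map_poly (\<lambda>p. poly p t) (pderiv Q)"
      unfolding cp by (simp add: poly_hom.map_poly_pderiv)
    also have "resultant ?c (map_poly (\<lambda>p. poly p t) (pderiv Q)) = poly (resultant Q (pderiv Q)) t"
      unfolding cp
    proof (rule poly_hom.resultant_map_poly)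
      \<comment> \<open>Specialization commutes with the resultant because no degree drops:
        \<open>Q\<close> is monic and the characteristic is 0.\<close>
      show "degree (map_poly (\<lambda>p. poly p t) Q) = degree Q" using dc cp Q by simp
      have "degree (pderiv ?c) = k - 1" using dc by (simp add: degree_pderiv)
      then show "degree (map_poly (\<lambda>p. poly p t) (pderiv Q)) = degree (pderiv Q)"
        unfolding cp using Q by (simp add: degree_pderiv poly_hom.map_poly_pderiv)
    qed
    also have "poly ?c 0 = poly (coeff Q 0) t" unfolding cp by (simp add: poly_0_coeff_0)
    finally show ?thesis unfolding W_def by simp
  qed
  then have "W \<noteq> 0" using s by auto
  then show ?thesis using poly_roots_finite[of W] key by simp
qed

section \<open>Spectra near a given element\<close>

lemma one_minus_invertible:
  fixes y :: "'a::complex_banach_algebra_1"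
  assumes y: "norm y < 1"
  obtains s where "s * (1 - y) = 1" "(1 - y) * s = 1"
proof -
  \<comment> \<open>The comparison starts at exponent 1 because the norm of the identity may exceed
    1.\<close>
  have bd: "norm (y ^ Suc n) \<le> norm y ^ Suc n" for n
  proof (induction n)
    case (Suc n)
    have "norm (y * y ^ Suc n) \<le> norm y * norm (y ^ Suc n)" by (rule norm_mult_ineq)
    also have "\<dots> \<le> norm y * norm y ^ Suc n" by (intro mult_left_mono Suc) simp
    finally show ?case by simp
  qed simp
  have g: "summable (\<lambda>n. norm y ^ Suc n)" using y by (simp add: summable_geometric summable_mult)
  have "summable (\<lambda>n. y ^ Suc n)"
    by (rule summable_comparison_test[OF _ g]) (use bd in blast)
  then have sm: "summable (\<lambda>n. y ^ n)" using summable_Suc_iff by blast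
  define s where "s = (\<Sum>n. y ^ n)"
  have "s = 1 + (\<Sum>n. y ^ Suc n)" unfolding s_def using suminf_split_head[OF sm] by simp
  moreover have "(\<Sum>n. y ^ Suc n) = y * s" unfolding s_def using suminf_mult[OF sm, of y] by simp
  moreover have "(\<Sum>n. y ^ Suc n) = s * y"
    unfolding s_def using suminf_mult2[OF sm, of y] by (simp add: power_commutes)
  ultimately have "s = 1 + y * s" "s = 1 + s * y" by simp_all
  then show ?thesis by (intro that[of s]) (simp_all add: algebra_simps)
qed

lemma notin_spectrumI:
  assumes "y * (c *\<^sub>C 1 - x) = 1" "(c *\<^sub>C 1 - x) * z = 1"
  shows "c \<notin> spectrum x"
proof -
  have "y = z" using assms by (metis mult.assoc mult_1_left mult_1_right)
  then show ?thesis using assms unfolding spectrum_def by blast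
qed

lemma spectrum_norm_le:
  assumes "c \<in> spectrum x"
  shows "cmod c \<le> norm x"
proof (rule ccontr)
  assume "\<not> ?thesis"
  then have c: "cmod c > norm x" "c \<noteq> 0" by auto
  have "norm (inverse c *\<^sub>C x) < 1" using c unfolding norm_scaleC norm_inverse by (simp add: divide_simps)
  then obtain s where "s * (1 - inverse c *\<^sub>C x) = 1" "(1 - inverse c *\<^sub>C x) * s = 1"
    by (rule one_minus_invertible)
  moreover have "c *\<^sub>C 1 - x = c *\<^sub>C (1 - inverse c *\<^sub>C x)"
    using c(2) by (simp add: complex_vector.scale_right_diff_distrib)
  ultimately have "c \<notin> spectrum x"
    using c(2) by (intro notin_spectrumI[of "inverse c *\<^sub>C s" _ _ "inverse c *\<^sub>C s"])
      (simp_all add: mult_scaleC_left mult_scaleC_right)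
  then show False using assms by simp
qed

lemma resolvent_set_neighbourhood:
  fixes a :: "'a::complex_banach_algebra_1"
  assumes "c \<notin> spectrum a"
  obtains d where "d > 0" "\<And>c' x. cmod (c' - c) < d \<Longrightarrow> norm (x - 1) < d \<Longrightarrow> c' \<notin> spectrum (x * a)"
proof -
  obtain b where b: "(c *\<^sub>C 1 - a) * b = 1" "b * (c *\<^sub>C 1 - a) = 1"
    using assms unfolding spectrum_def by blast
  \<comment> \<open>Perturbations below \<open>inverse K\<close> give
    \<open>norm b * norm h \<le> (K - 1) / K < 1\<close>.\<close>
  define K where "K = norm b * (norm (1::'a) + norm a) + 1"
  have K: "K > 0" unfolding K_def by (intro add_nonneg_pos mult_nonneg_nonneg) auto
  show ?thesis
  proof (rule that[of "inverse K"])
    fix c' and x :: 'a assume c': "cmod (c' - c) < inverse K" and x: "norm (x - 1) < inverse K"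
    define h where "h = (x - 1) * a - (c' - c) *\<^sub>C 1"
    have "norm h \<le> norm (x - 1) * norm a + cmod (c' - c) * norm (1::'a)"
      unfolding h_def by (intro norm_triangle_le_diff add_mono norm_mult_ineq) (simp add: norm_scaleC)
    also have "\<dots> \<le> inverse K * norm a + inverse K * norm (1::'a)"
      using c' x by (intro add_mono mult_right_mono) auto
    finally have h: "norm h \<le> (norm (1::'a) + norm a) / K" by (simp add: divide_inverse algebra_simps)
    have "norm b * norm h \<le> norm b * ((norm (1::'a) + norm a) / K)" by (intro mult_left_mono h) simp
    also have "\<dots> < 1" using K by (simp add: K_def divide_less_eq)
    finally have nb: "norm b * norm h < 1" .
    \<comment> \<open>Two factorizations are needed: this one produces a left inverse, the next a
      right inverse.\<close>
    have u: "c' *\<^sub>C 1 - x * a = (c *\<^sub>C 1 - a) * (1 - b * h)"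
      using b by (simp add: h_def right_diff_distrib complex_vector.scale_left_diff_distrib
          left_diff_distrib flip: mult.assoc)
    have v: "c' *\<^sub>C 1 - x * a = (1 - h * b) * (c *\<^sub>C 1 - a)"
    proof -
      have "h * b * (c *\<^sub>C 1 - a) = h" using b by (simp add: mult.assoc)
      then show ?thesis by (simp add: left_diff_distrib h_def complex_vector.scale_left_diff_distrib)
    qed
    obtain s where s: "s * (1 - b * h) = 1"
      using one_minus_invertible[of "b * h"] nb norm_mult_ineq[of b h] by fastforce
    obtain t where t: "(1 - h * b) * t = 1"
      using one_minus_invertible[of "h * b"] nb norm_mult_ineq[of h b] by (metis le_less_trans mult.commute)
    show "c' \<notin> spectrum (x * a)"
    proof (rule notin_spectrumI)
      show "(s * b) * (c' *\<^sub>C 1 - x * a) = 1"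
      proof -
        have "(s * b) * (c' *\<^sub>C 1 - x * a) = s * ((b * (c *\<^sub>C 1 - a)) * (1 - b * h))"
          unfolding u by (simp add: mult.assoc)
        then show ?thesis by (simp add: b s)
      qed
      show "(c' *\<^sub>C 1 - x * a) * (b * t) = 1"
      proof -
        have "(c' *\<^sub>C 1 - x * a) * (b * t) = (1 - h * b) * (((c *\<^sub>C 1 - a) * b) * t)"
          unfolding v by (simp add: mult.assoc)
        then show ?thesis by (simp add: b t)
      qed
    qed
  qed (use K in simp)
qed

lemma resolvent_set_compact:
  fixes a :: "'a::complex_banach_algebra_1"
  assumes K: "compact K" "K \<inter> spectrum a = {}"
  obtains d where "d > 0" "\<And>c x. c \<in> K \<Longrightarrow> norm (x - 1) < d \<Longrightarrow> c \<notin> spectrum (x * a)"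
proof -
  have "\<forall>c\<in>K. \<exists>d>0. \<forall>c' x. cmod (c' - c) < d \<longrightarrow> norm (x - 1) < d \<longrightarrow> c' \<notin> spectrum (x * a)"
    using K(2) resolvent_set_neighbourhood by (metis disjoint_iff)
  then obtain d where d: "\<And>c. c \<in> K \<Longrightarrow> d c > 0"
    "\<And>c c' x. c \<in> K \<Longrightarrow> cmod (c' - c) < d c \<Longrightarrow> norm (x - 1) < d c \<Longrightarrow> c' \<notin> spectrum (x * a)"
    by metis
  have "K \<subseteq> (\<Union>c\<in>K. ball c (d c))" using d(1) by auto
  then obtain T where T: "T \<subseteq> K" "finite T" "K \<subseteq> (\<Union>c\<in>T. ball c (d c))"
    using compactE_image[OF K(1), of K "\<lambda>c. ball c (d c)"] by blast
  show ?thesis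
  proof (rule that[of "Min (insert 1 (d ` T))"])
    show "Min (insert 1 (d ` T)) > 0" using T d(1) by auto
    fix c and x :: 'a assume "c \<in> K" and x: "norm (x - 1) < Min (insert 1 (d ` T))"
    then obtain c0 where "c0 \<in> T" "c \<in> ball c0 (d c0)" using T(3) by blast
    then show "c \<notin> spectrum (x * a)"
      using d(2)[of c0 c x] x T by (auto simp: dist_norm norm_minus_commute)
  qed
qed

text \<open>Two admissible disks differ by an annulus that misses the spectrum of \<open>a\<close>.
  By compactness it misses the spectrum of \<open>x * a\<close> for all \<open>x\<close> near
  \<open>1\<close>, so both disks give the same count there; density supplies an \<open>x\<close>
  that serves both.\<close>

lemma multiplicity_at_eqI:
  fixes a :: "'a::complex_banach_algebra_1"
  assumes dense: "\<And>\<epsilon>. \<epsilon> > 0 \<Longrightarrow> rank_attaining a \<inter> ball 1 \<epsilon> \<noteq> {}"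
    and r: "r > 0" "cball \<mu> r \<inter> spectrum a = {\<mu>}" and e: "\<epsilon> > 0"
      "\<And>x. x \<in> rank_attaining a \<Longrightarrow> x \<in> ball 1 \<epsilon> \<Longrightarrow> ecard (spectrum (x * a) \<inter> ball \<mu> r) = enat n"
  shows "multiplicity_at \<mu> a = n"
  unfolding multiplicity_at_def
proof (rule the_equality)
  show "\<exists>r>0. cball \<mu> r \<inter> spectrum a = {\<mu>} \<and>
        (\<exists>\<epsilon>>0. \<forall>x\<in>rank_attaining a \<inter> ball 1 \<epsilon>. ecard (spectrum (x * a) \<inter> ball \<mu> r) = enat n)"
    using r e by blast
  fix m
  assume "\<exists>r>0. cball \<mu> r \<inter> spectrum a = {\<mu>} \<and>
        (\<exists>\<epsilon>>0. \<forall>x\<in>rank_attaining a \<inter> ball 1 \<epsilon>. ecard (spectrum (x * a) \<inter> ball \<mu> r) = enat m)"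
  then obtain r' e' where r': "r' > 0" "cball \<mu> r' \<inter> spectrum a = {\<mu>}" and e': "e' > 0"
    "\<And>x. x \<in> rank_attaining a \<Longrightarrow> x \<in> ball 1 e' \<Longrightarrow> ecard (spectrum (x * a) \<inter> ball \<mu> r') = enat m"
    by blast
  define K where "K = cball \<mu> (max r r') - ball \<mu> (min r r')"
  have "compact K" unfolding K_def by (intro compact_diff) auto
  moreover have "K \<inter> spectrum a = {}"
  proof -
    have c: "c = \<mu>" if "c \<in> spectrum a" "c \<in> cball \<mu> (max r r')" for c
    proof -
      have "c \<in> cball \<mu> r \<inter> spectrum a \<or> c \<in> cball \<mu> r' \<inter> spectrum a"
        using that by (auto simp: max_def split: if_splits)
      then show ?thesis unfolding r(2) r'(2) by simp
    qed
    have "\<mu> \<notin> K" using r(1) r'(1) unfolding K_def by simp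
    then show ?thesis using c unfolding K_def by blast
  qed
  ultimately obtain d where d: "d > 0" "\<And>c x. c \<in> K \<Longrightarrow> norm (x - 1) < d \<Longrightarrow> c \<notin> spectrum (x * a)"
    using resolvent_set_compact by blast
  have "Min {\<epsilon>, e', d} > 0" using e e' d by simp
  then obtain x where x: "x \<in> rank_attaining a" "x \<in> ball 1 (Min {\<epsilon>, e', d})" using dense by blast
  then have "norm (x - 1) < d" by (simp add: dist_norm norm_minus_commute)
  then have "spectrum (x * a) \<inter> K = {}" using d(2) by blast
  then have "spectrum (x * a) \<inter> ball \<mu> r = spectrum (x * a) \<inter> ball \<mu> r'"
    unfolding K_def disjoint_iff set_eq_iff by (cases "r \<le> r'") (force simp: max_def min_def)+
  then show "m = n" using e(2)[of x] e'(2)[of x] x by simp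
qed

section \<open>Sums over minimal idempotents\<close>

definition minimal_idempotent :: "'a::complex_banach_algebra_1 \<Rightarrow> bool" where
  "minimal_idempotent p \<longleftrightarrow> p \<noteq> 0 \<and> p * p = p \<and> (\<forall>x. \<exists>c. p * x * p = c *\<^sub>C p)"

lemma simple_left_minimal_idempotent:
  assumes e: "simple_left e" "e * e = e"
  shows "minimal_idempotent e"
  unfolding minimal_idempotent_def
proof (intro conjI allI)
  show "e \<noteq> 0" "e * e = e" using e by (simp_all add: simple_left_def)
  have "\<exists>v. v * (e * x * e) = e" if "e * x * e \<noteq> 0" for x
    using e(1) that unfolding simple_left_def by blast
  then show "\<exists>c. e * x * e = c *\<^sub>C e" for x
    using corner_scalar[of e] \<open>e \<noteq> 0\<close> e(2) by metis
qed

text \<open>Semiprimeness makes some \<open>p * w * x * p\<close> nonzero, hence a nonzero multiple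
  of \<open>p\<close>, which is rescaled. The mirror image follows.\<close>

lemma minimal_idempotent_solve_left:
  assumes ss: "semisimple TYPE('a::complex_banach_algebra_1)"
    and p: "minimal_idempotent (p::'a)" and x: "x * p \<noteq> 0"
  obtains z where "z * x * p = p"
proof -
  note p' = p[unfolded minimal_idempotent_def]
  obtain w where "x * p * w * (x * p) \<noteq> 0" using semiprime[OF ss x] by blast
  then have nz: "p * (w * x) * p \<noteq> 0" by (auto simp: mult.assoc)
  obtain c where c: "p * (w * x) * p = c *\<^sub>C p" using p' by blast
  then have "c \<noteq> 0" using nz by auto
  then have "(inverse c *\<^sub>C (p * w)) * x * p = p" using c by (simp add: mult_scaleC_left mult.assoc scaleC_scaleC)
  then show ?thesis using that by blast
qed

lemma minimal_idempotent_solve_right: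
  assumes ss: "semisimple TYPE('a::complex_banach_algebra_1)"
    and p: "minimal_idempotent (p::'a)" and y: "p * y \<noteq> 0"
  obtains z where "p * y * z * p = p"
proof -
  note p' = p[unfolded minimal_idempotent_def]
  obtain w where "p * y * w * (p * y) \<noteq> 0" using semiprime[OF ss y] by blast
  then have nz: "p * (y * w) * p \<noteq> 0" by (auto simp flip: mult.assoc)
  obtain c where c: "p * (y * w) * p = c *\<^sub>C p" using p' by blast
  then have "c \<noteq> 0" using nz by auto
  then have "p * y * (inverse c *\<^sub>C w) * p = p"
    using c by (simp add: mult_scaleC_left mult_scaleC_right mult.assoc scaleC_scaleC)
  then show ?thesis using that by blast
qed

text \<open>The set \<open>q A p\<close> is the space of module homomorphisms from
  \<open>A q\<close> to \<open>A p\<close>; for minimal idempotents, being linked is isomorphism of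
  these simple modules.\<close>

definition linked :: "'a::complex_banach_algebra_1 \<Rightarrow> 'a \<Rightarrow> bool" where
  "linked q p \<longleftrightarrow> (\<exists>x. q * x * p \<noteq> 0)"

lemma linked_sym:
  assumes ss: "semisimple TYPE('a::complex_banach_algebra_1)" and "linked (q::'a) p"
  shows "linked p q"
proof -
  obtain x where "q * x * p \<noteq> 0" using assms(2) unfolding linked_def by blast
  then obtain w where "q * x * p * w * (q * x * p) \<noteq> 0" using semiprime[OF ss] by blast
  moreover have "q * x * p * w * (q * x * p) = q * x * (p * w * q) * (x * p)" by (simp add: mult.assoc)
  ultimately have "p * w * q \<noteq> 0" by auto
  then show ?thesis unfolding linked_def by blast
qed

lemma linked_trans:
  assumes ss: "semisimple TYPE('a::complex_banach_algebra_1)"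
    and p: "minimal_idempotent (p::'a)" and l: "linked q p" "linked p r"
  shows "linked q r"
proof -
  obtain x y where xy: "(q * x) * p \<noteq> 0" "p * y * r \<noteq> 0" using l unfolding linked_def by (auto simp: mult.assoc)
  obtain z where "z * (q * x) * p = p" using minimal_idempotent_solve_left[OF ss p xy(1)] .
  then have "p * y * r = z * (q * (x * p * y) * r)" by (simp add: mult.assoc) (metis mult.assoc)
  then have "q * (x * p * y) * r \<noteq> 0" using xy(2) by auto
  then show ?thesis unfolding linked_def by blast
qed

text \<open>\<open>orthogonal\<close> keeps different classes from interacting. \<open>cover\<close>
  asks for a single product and not a sum, so that passing to representatives in
  \<open>Soc_rep\<close> does not increase the number of summands.\<close>

locale idempotent_system =
  fixes P :: "'a::complex_banach_algebra_1 set"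
  assumes ss: "semisimple TYPE('a)"
    and minimal: "p \<in> P \<Longrightarrow> minimal_idempotent p"
    and orthogonal: "p \<in> P \<Longrightarrow> q \<in> P \<Longrightarrow> p \<noteq> q \<Longrightarrow> p * x * q = 0"
    and cover: "minimal_idempotent q \<Longrightarrow> \<exists>p\<in>P. \<exists>x y. q = x * p * y"

lemma idempotent_system_exists:
  assumes ss: "semisimple TYPE('a::complex_banach_algebra_1)"
  obtains P :: "'a::complex_banach_algebra_1 set" where "idempotent_system P"
proof -
  \<comment> \<open>Linked idempotents satisfy the same choice predicate, so they receive the same
    representative.\<close>
  define rep where "rep q = (SOME p::'a. minimal_idempotent p \<and> linked q p)" for q
  have rep: "minimal_idempotent (rep q) \<and> linked q (rep q)" if q: "minimal_idempotent q" for q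
    unfolding rep_def
  proof (rule someI)
    have "q * 1 * q \<noteq> 0" using q unfolding minimal_idempotent_def by simp
    then show "minimal_idempotent q \<and> linked q q" using q unfolding linked_def by blast
  qed
  have "idempotent_system (rep ` {q. minimal_idempotent q})"
  proof
    show "semisimple TYPE('a)" by (rule ss)
    show "minimal_idempotent p" if "p \<in> rep ` {q. minimal_idempotent q}" for p using that rep by auto
    fix p r x assume "p \<in> rep ` {q. minimal_idempotent q}" "r \<in> rep ` {q. minimal_idempotent q}" and ne: "p \<noteq> r"
    then obtain q s where q: "p = rep q" "minimal_idempotent q" and s: "r = rep s" "minimal_idempotent s" by blast
    show "p * x * r = 0"
    proof (rule ccontr)
      assume "p * x * r \<noteq> 0"
      then have "linked p r" unfolding linked_def by blast
      then have l: "linked q s"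
        using rep q s linked_sym[OF ss] linked_trans[OF ss] by metis
      have "minimal_idempotent t \<and> linked q t \<longleftrightarrow> minimal_idempotent t \<and> linked s t" for t
        using l linked_sym[OF ss] linked_trans[OF ss] q s by metis
      then have "rep q = rep s" unfolding rep_def by simp
      then show False using ne q s by simp
    qed
  next
    fix q :: 'a assume q: "minimal_idempotent q"
    note q' = q[unfolded minimal_idempotent_def]
    define p where "p = rep q"
    have p: "minimal_idempotent p" "linked q p" using rep[OF q] by (auto simp: p_def)
    then obtain x where "(q * x) * p \<noteq> 0" unfolding linked_def by blast
    then obtain y where y: "y * (q * x) * p = p" using minimal_idempotent_solve_left[OF ss p(1)] by blast
    \<comment> \<open>\<open>e\<close> is a multiple of \<open>q\<close> that fixes the nonzero
      element \<open>q * x * p\<close>; hence the scalar is 1 and \<open>e = q\<close>.\<close>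
    define e where "e = q * x * p * y * q"
    have qq: "q * (q * z) = q * z" for z using q' by (metis mult.assoc)
    have pp: "p * p = p" using p(1) by (simp add: minimal_idempotent_def)
    have "e * (q * x * p) = q * x * p" using y by (simp add: e_def mult.assoc qq pp)
    moreover have "q * x * p \<noteq> 0" using \<open>(q * x) * p \<noteq> 0\<close> .
    moreover obtain c where c: "e = c *\<^sub>C q" using q' unfolding e_def by (metis mult.assoc)
    ultimately have "c *\<^sub>C (q * x * p) = 1 *\<^sub>C (q * x * p)" using q' by (simp add: mult_scaleC_left flip: mult.assoc)
    then have "c = 1" using \<open>(q * x) * p \<noteq> 0\<close> complex_vector.scale_right_imp_eq by blast
    then have "q = (q * x) * p * (y * q)" using c by (simp add: e_def mult.assoc)
    then show "\<exists>p\<in>rep ` {q. minimal_idempotent q}. \<exists>x y. q = x * p * y" using p_def q by blast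
  qed
  then show ?thesis using that by blast
qed

section \<open>Formal sums of products \<open>x p y\<close> and their weighted traces\<close>

type_synonym 'b rep = "('b \<times> 'b \<times> 'b) list"

context idempotent_system
begin

lemma P_nonzero: "p \<in> P \<Longrightarrow> p \<noteq> 0" and P_idem: "p \<in> P \<Longrightarrow> p * p = p"
  using minimal unfolding minimal_idempotent_def by blast+

text \<open>Orthogonality forces the value 0 for \<open>p \<noteq> q\<close>; with it
  \<open>p * y * q = entry p q y *\<^sub>C p\<close> holds for all pairs from \<open>P\<close>. For
  equal arguments the choice is definite since \<open>p\<close> is nonzero.\<close>

definition entry :: "'a \<Rightarrow> 'a \<Rightarrow> 'a \<Rightarrow> complex" where
  "entry p q y = (if p = q then SOME c. p * y * p = c *\<^sub>C p else 0)"

lemma entry_left: "p \<in> P \<Longrightarrow> q \<in> P \<Longrightarrow> p * y * q = entry p q y *\<^sub>C p"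
  using someI_ex[of "\<lambda>c. p * y * p = c *\<^sub>C p"] minimal orthogonal
  unfolding entry_def minimal_idempotent_def by auto

lemma entry_right: "p \<in> P \<Longrightarrow> q \<in> P \<Longrightarrow> p * y * q = entry p q y *\<^sub>C q"
  using entry_left[of p q y] by (cases "p = q") (auto simp: entry_def)

lemma scaleC_P_cancel: "p \<in> P \<Longrightarrow> c *\<^sub>C p = d *\<^sub>C p \<longleftrightarrow> c = d"
  using P_nonzero complex_vector.scale_right_imp_eq by blast

lemma entry_eqI: "p \<in> P \<Longrightarrow> p * y * p = c *\<^sub>C p \<Longrightarrow> entry p p y = c"
  using entry_left scaleC_P_cancel by metis

lemma entry_add: "p \<in> P \<Longrightarrow> q \<in> P \<Longrightarrow> entry p q (y + z) = entry p q y + entry p q z"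
  by (subst scaleC_P_cancel[of p, symmetric])
    (simp_all add: scaleC_add_left distrib_left distrib_right flip: entry_left)

lemma entry_scaleC: "p \<in> P \<Longrightarrow> q \<in> P \<Longrightarrow> entry p q (c *\<^sub>C y) = c * entry p q y"
  by (subst scaleC_P_cancel[of p, symmetric])
    (simp_all add: mult_scaleC_left mult_scaleC_right flip: entry_left scaleC_scaleC)

lemma entry_diff: "p \<in> P \<Longrightarrow> q \<in> P \<Longrightarrow> entry p q (y - z) = entry p q y - entry p q z"
  using entry_add[of p q "y - z" z] by simp

lemma entry_minus: "p \<in> P \<Longrightarrow> q \<in> P \<Longrightarrow> entry p q (- y) = - entry p q y"
  using entry_scaleC[of p q "-1" y] by simp

lemma entry_norm_le:
  assumes "p \<in> P" "q \<in> P"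
  shows "cmod (entry p q y) \<le> norm q * norm y"
proof -
  have "norm (p * (y * q)) \<le> norm p * (norm y * norm q)"
    by (intro order_trans[OF norm_mult_ineq] mult_left_mono norm_mult_ineq) simp
  moreover have "p * (y * q) = entry p q y *\<^sub>C p" using entry_left[OF assms] by (metis mult.assoc)
  ultimately have "cmod (entry p q y) * norm p \<le> norm p * (norm y * norm q)" by (simp add: norm_scaleC)
  also have "\<dots> = (norm q * norm y) * norm p" by (simp only: mult_ac)
  finally show ?thesis using P_nonzero[OF assms(1)] by simp
qed

lemma tendsto_entry:
  assumes "p \<in> P" "q \<in> P" "(f \<longlongrightarrow> y) F"
  shows "((\<lambda>n. entry p q (f n)) \<longlongrightarrow> entry p q y) F"
proof -
  have le: "norm (entry p q (f n) - entry p q y) \<le> norm q * norm (f n - y)" for n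
    using entry_norm_le[OF assms(1,2), of "f n - y"] by (simp add: entry_diff assms(1,2))
  have "((\<lambda>n. norm q * norm (f n - y)) \<longlongrightarrow> norm q * norm (y - y)) F"
    by (intro tendsto_intros assms)
  then have "((\<lambda>n. entry p q (f n) - entry p q y) \<longlongrightarrow> 0) F"
    by (intro Lim_null_comparison[OF always_eventually[OF allI[OF le]]]) simp
  then show ?thesis by (simp add: LIM_zero_iff)
qed

definition valid :: "'a rep \<Rightarrow> bool" where
  "valid ts \<longleftrightarrow> (\<forall>(x, p, y)\<in>set ts. p \<in> P)"

definition val :: "'a rep \<Rightarrow> 'a" where
  "val ts = (\<Sum>(x, p, y)\<leftarrow>ts. x * p * y)"

definition rep_trace :: "('a \<Rightarrow> complex) \<Rightarrow> 'a rep \<Rightarrow> complex" where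
  "rep_trace w ts = (\<Sum>(x, p, y)\<leftarrow>ts. w p * entry p p (y * x))"

lemma rep_simps [simp]:
  "valid []" "valid ((x, p, y) # ts) \<longleftrightarrow> p \<in> P \<and> valid ts" "valid (ts @ us) \<longleftrightarrow> valid ts \<and> valid us"
  "val [] = 0" "val ((x, p, y) # ts) = x * p * y + val ts" "val (ts @ us) = val ts + val us"
  "rep_trace w [] = 0" "rep_trace w ((x, p, y) # ts) = w p * entry p p (y * x) + rep_trace w ts"
  "rep_trace w (ts @ us) = rep_trace w ts + rep_trace w us"
  by (auto simp: valid_def ball_Un val_def rep_trace_def)

lemma val_mult_corner:
  assumes "valid ts" "q \<in> P"
  shows "val ts * z * q = (\<Sum>(x, p, y)\<leftarrow>ts. entry p q (y * z) *\<^sub>C (x * p))"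
  using assms(1)
proof (induction ts)
  case (Cons t ts)
  obtain x p y where t: "t = (x, p, y)" by (cases t)
  have "x * p * y * z * q = x * (p * (y * z) * q)" by (simp add: mult.assoc)
  also have "\<dots> = entry p q (y * z) *\<^sub>C (x * p)"
    using Cons.prems assms(2) t by (simp add: entry_left mult_scaleC_right)
  finally show ?case using Cons t by (simp add: distrib_right)
qed simp

text \<open>
  Induction on the number of terms: a term \<open>u q v\<close> with \<open>q v \<noteq> 0\<close> is eliminated by solving for
  \<open>u q\<close> in terms of the other \<open>x p\<close>.
\<close>

lemma rep_trace_zero:
  assumes "valid ts" "val ts = 0"
  shows "rep_trace w ts = 0"
  using assms
proof (induction "length ts" arbitrary: ts)
  case (Suc n)
  then obtain u q v us where ts: "ts = (u, q, v) # us" and us: "length us = n"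
    by (cases ts) auto
  have q: "q \<in> P" and vus: "valid us" using Suc.prems ts by auto
  show ?case
  proof (cases "q * v = 0")
    case True
    then have "val us = 0" using Suc.prems ts by (simp add: mult.assoc)
    moreover have "entry q q (v * u) = 0"
      by (rule entry_eqI[OF q]) (use True in \<open>simp flip: mult.assoc\<close>)
    ultimately show ?thesis using Suc.hyps(1)[of us] us vus ts by simp
  next
    case False
    obtain z where z: "q * v * z * q = q"
      using minimal_idempotent_solve_right[OF ss minimal[OF q] False] .
    \<comment> \<open>These are the coefficients in the relation that expresses \<open>u * q\<close>
      by the other \<open>x * p\<close>, obtained by multiplying \<open>val ts = 0\<close> by
      \<open>z * q\<close> on the right.\<close>
    define c where "c p y = entry p q (y * z)" for p y
    \<comment> \<open>Substituting that relation into \<open>u * q * v\<close> turns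
      \<open>val ts\<close> into \<open>val us'\<close>, with one term fewer.\<close>
    define us' where "us' = map (\<lambda>(x, p, y). (x, p, y - c p y *\<^sub>C v)) us"
    define s where "s = (\<Sum>(x, p, y)\<leftarrow>us. c p y *\<^sub>C (x * p))"
    have "val ts * z * q = u * (q * v * z * q) + s"
      using val_mult_corner[OF vus q, of z] by (simp add: ts s_def c_def distrib_right mult.assoc)
    then have uq: "u * q = - s" using Suc.prems(2) z by (simp add: eq_neg_iff_add_eq_0)
    have v1: "val us' = val us - s * v"
      unfolding us'_def s_def val_def
      by (induction us) (auto simp: algebra_simps mult_scaleC_right mult_scaleC_left)
    then have v0: "val us' = 0" using Suc.prems(2) uq by (simp add: ts)
    have "valid us'" using vus unfolding us'_def valid_def by auto
    then have r0: "rep_trace w us' = 0" using Suc.hyps(1)[of us'] us v0 by (simp add: us'_def)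
    \<comment> \<open>As \<open>c p y\<close> vanishes for \<open>p \<noteq> q\<close>, every
      correction carries the weight \<open>w q\<close>; this is why arbitrary weights are
      admissible.\<close>
    have key: "c p y *\<^sub>C (q * v * (x * p) * q) = (c p y * entry p p (v * x)) *\<^sub>C q \<and>
        w q * c p y = w p * c p y" if "p \<in> P" for x p y
    proof (cases "p = q")
      case True
      have "q * v * (x * q) * q = q * (v * x) * q" using P_idem[OF q] by (simp add: mult.assoc)
      then show ?thesis using True entry_left[OF q q] by (simp add: scaleC_scaleC)
    qed (simp add: c_def entry_def)
    have "q * v * s * q = (\<Sum>(x, p, y)\<leftarrow>us. c p y * entry p p (v * x)) *\<^sub>C q \<and>
      rep_trace w us' = rep_trace w us - w q * (\<Sum>(x, p, y)\<leftarrow>us. c p y * entry p p (v * x))"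
      unfolding s_def us'_def using vus
    proof (induction us)
      case (Cons t us)
      obtain x p y where t: "t = (x, p, y)" by (cases t)
      have p: "p \<in> P" using Cons.prems t by simp
      have "w p * entry p p ((y - c p y *\<^sub>C v) * x) =
          w p * entry p p (y * x) - w q * (c p y * entry p p (v * x))"
        using key[OF p, of y x] p
        by (simp add: left_diff_distrib mult_scaleC_left entry_diff entry_scaleC right_diff_distrib mult_ac)
          (metis mult.assoc mult.commute)
      then show ?case
        using Cons key[OF p, of y x] t
        by (simp add: algebra_simps scaleC_add_left mult_scaleC_left mult_scaleC_right)
    qed simp
    then have 1: "q * v * s * q = (\<Sum>(x, p, y)\<leftarrow>us. c p y * entry p p (v * x)) *\<^sub>C q"
      and 2: "rep_trace w us = w q * (\<Sum>(x, p, y)\<leftarrow>us. c p y * entry p p (v * x))"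
      using r0 by auto
    have "s = - (u * q)" using uq by simp
    then have "q * (v * u) * q = - (q * v * s * q)"
      using P_idem[OF q] by (simp add: mult.assoc)
    then have "entry q q (v * u) = - (\<Sum>(x, p, y)\<leftarrow>us. c p y * entry p p (v * x))"
      unfolding 1 by (intro entry_eqI[OF q]) simp
    then show ?thesis using 2 by (simp add: ts)
  qed
qed simp

lemma rep_negate:
  "\<exists>us. (valid us \<longleftrightarrow> valid ts) \<and> val us = - val ts \<and>
    (valid ts \<longrightarrow> rep_trace w us = - rep_trace w ts)"
proof (intro exI[of _ "map (\<lambda>(x, p, y). (- x, p, y)) ts"] conjI impI)
  show "valid (map (\<lambda>(x, p, y). (- x, p, y)) ts) = valid ts" by (force simp: valid_def)
  show "val (map (\<lambda>(x, p, y). (- x, p, y)) ts) = - val ts"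
    by (induction ts) auto
  show "rep_trace w (map (\<lambda>(x, p, y). (- x, p, y)) ts) = - rep_trace w ts" if "valid ts"
    using that by (induction ts) (auto simp: entry_minus)
qed

lemma rep_trace_unique:
  assumes "valid ts" "valid us" "val ts = val us"
  shows "rep_trace w ts = rep_trace w us"
proof -
  obtain us' where "valid us'" "val us' = - val us" "rep_trace w us' = - rep_trace w us"
    using rep_negate[of us w] assms(2) by blast
  then show ?thesis using rep_trace_zero[of "ts @ us'" w] assms by simp
qed

definition weighted_trace :: "('a \<Rightarrow> complex) \<Rightarrow> 'a \<Rightarrow> complex" where
  "weighted_trace w a = rep_trace w (SOME ts. valid ts \<and> val ts = a)"

lemma weighted_trace_val:
  assumes "valid ts"
  shows "weighted_trace w (val ts) = rep_trace w ts"
  unfolding weighted_trace_def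
  by (rule rep_trace_unique) (use someI[of "\<lambda>us. valid us \<and> val us = val ts"] assms in auto)

lemma rep_scaleC:
  "valid ts \<Longrightarrow> \<exists>us. valid us \<and> val us = c *\<^sub>C val ts \<and> rep_trace w us = c * rep_trace w ts"
proof (intro exI[of _ "map (\<lambda>(x, p, y). (c *\<^sub>C x, p, y)) ts"] conjI)
  assume "valid ts"
  then show "valid (map (\<lambda>(x, p, y). (c *\<^sub>C x, p, y)) ts)" by (force simp: valid_def)
  show "val (map (\<lambda>(x, p, y). (c *\<^sub>C x, p, y)) ts) = c *\<^sub>C val ts"
    by (induction ts) (auto simp: mult_scaleC_left scaleC_add_right)
  show "rep_trace w (map (\<lambda>(x, p, y). (c *\<^sub>C x, p, y)) ts) = c * rep_trace w ts"
    using \<open>valid ts\<close> by (induction ts) (auto simp: mult_scaleC_right entry_scaleC algebra_simps)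
qed

text \<open>Moving \<open>b\<close> from the left of \<open>x\<close> to the right of
  \<open>y\<close> leaves the product \<open>y * b * x\<close> unchanged, and the trace of a term
  depends only on this product and on \<open>p\<close>.\<close>

lemma rep_mult:
  assumes "valid ts"
  obtains us vs where "valid us" "val us = b * val ts" "valid vs" "val vs = val ts * b"
    "rep_trace w us = rep_trace w vs"
proof (rule that)
  let ?us = "map (\<lambda>(x, p, y). (b * x, p, y)) ts" and ?vs = "map (\<lambda>(x, p, y). (x, p, y * b)) ts"
  show "valid ?us" "valid ?vs" using assms by (force simp: valid_def)+
  show "val ?us = b * val ts" by (induction ts) (auto simp: algebra_simps)
  show "val ?vs = val ts * b" by (induction ts) (auto simp: algebra_simps)
  show "rep_trace w ?us = rep_trace w ?vs" by (induction ts) (auto simp: algebra_simps)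
qed

lemma Soc_rep:
  assumes "a \<in> Soc"
  obtains ts where "valid ts" "val ts = a" "enat (length ts) \<le> spectral_rank a"
proof -
  obtain k e where a: "a = (\<Sum>i<k::nat. e i * a)" and k: "enat k \<le> spectral_rank a"
    and s: "\<And>i. i < k \<Longrightarrow> simple_left (e i * a)"
    by (rule Soc_decomposition[OF ss assms]) blast
  have "\<exists>x p y. p \<in> P \<and> e i * a = x * p * y" if i: "i < k" for i
  proof -
    obtain f where f: "simple_left f" "f * f = f" "e i * a * f = e i * a"
      using simple_left_idempotent[OF ss s[OF i]] by blast
    obtain p x y where "p \<in> P" "f = x * p * y"
      using cover[OF simple_left_minimal_idempotent[OF f(1,2)]] by blast
    then have "p \<in> P" "e i * a = (e i * a * x) * p * y" using f(3) by (simp_all add: mult.assoc)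
    then show ?thesis by blast
  qed
  then obtain x p y where xpy: "\<And>i. i < k \<Longrightarrow> p i \<in> P \<and> e i * a = x i * p i * y i" by metis
  define ts where "ts = map (\<lambda>i. (x i, p i, y i)) [0..<k]"
  have "val ts = (\<Sum>i<k. x i * p i * y i)"
    by (simp add: ts_def val_def o_def sum_list_sum_nth atLeast0LessThan)
  also have "\<dots> = a" using xpy by (subst a) simp
  finally show ?thesis using that[of ts] xpy k by (auto simp: ts_def valid_def)
qed

end

section \<open>Spectra, multiplicities and the trace\<close>

text \<open>\<open>N\<close> is the inverse of \<open>c 1 - A\<close>, obtained from the adjugate.
  The equations \<open>A N = c N - 1 = N A\<close> are spelled out by entries so that they can serve
  as coefficients of algebra elements.\<close>

lemma char_matrix_inverse:
  fixes A :: "complex mat"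
  assumes A: "A \<in> carrier_mat k k" and nz: "poly (char_poly A) c \<noteq> 0"
  shows "\<exists>N. \<forall>i<k. \<forall>j<k.
    (\<Sum>l<k. A $$ (i,l) * N l j) = c * N i j - (if i = j then 1 else 0) \<and>
    (\<Sum>l<k. N i l * A $$ (l,j)) = c * N i j - (if i = j then 1 else 0)"
proof -
  define B where "B = - char_matrix A c"
  have B: "B \<in> carrier_mat k k" using A by (simp add: B_def char_matrix_def)
  have Bij: "B $$ (i,j) = (if i = j then c else 0) - A $$ (i,j)" if "i < k" "j < k" for i j
    using A that by (auto simp: B_def char_matrix_def)
  have d: "Determinant.det B \<noteq> 0" using nz unfolding B_def char_poly_matrix[OF A] .
  define N where "N i j = adj_mat B $$ (i,j) / Determinant.det B" for i j
  note adj = adj_mat[OF B]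
  show ?thesis
  proof (intro exI[of _ N] allI impI conjI)
    fix i j assume ij: "i < k" "j < k"
    have "(B * adj_mat B) $$ (i,j) = (\<Sum>l<k. B $$ (i,l) * adj_mat B $$ (l,j))"
      using B adj(1) ij by (auto simp: scalar_prod_def atLeast0LessThan)
    then have "(\<Sum>l<k. B $$ (i,l) * N l j) = (if i = j then 1 else 0)"
      using adj(2) ij d by (cases "i = j") (simp_all add: N_def flip: sum_divide_distrib)
    moreover have "(\<Sum>l<k. B $$ (i,l) * N l j) = (\<Sum>l<k. (if i = l then c else 0) * N l j) - (\<Sum>l<k. A $$ (i,l) * N l j)"
      using ij by (simp add: Bij left_diff_distrib sum_subtractf)
    moreover have "(\<Sum>l<k. (if i = l then c else 0) * N l j) = c * N i j"
      using ij by (subst sum.cong[OF refl, of _ _ "\<lambda>l. if i = l then c * N l j else 0"]) auto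
    ultimately show "(\<Sum>l<k. A $$ (i,l) * N l j) = c * N i j - (if i = j then 1 else 0)"
      by (simp add: algebra_simps)
    have "(adj_mat B * B) $$ (i,j) = (\<Sum>l<k. adj_mat B $$ (i,l) * B $$ (l,j))"
      using B adj(1) ij by (auto simp: scalar_prod_def atLeast0LessThan)
    then have "(\<Sum>l<k. N i l * B $$ (l,j)) = (if i = j then 1 else 0)"
      using adj(3) ij d by (cases "i = j") (simp_all add: N_def flip: sum_divide_distrib)
    moreover have "(\<Sum>l<k. N i l * B $$ (l,j)) = (\<Sum>l<k. N i l * (if l = j then c else 0)) - (\<Sum>l<k. N i l * A $$ (l,j))"
      using ij by (simp add: Bij right_diff_distrib sum_subtractf)
    moreover have "(\<Sum>l<k. N i l * (if l = j then c else 0)) = c * N i j"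
      using ij by (subst sum.cong[OF refl, of _ _ "\<lambda>l. if l = j then c * N i l else 0"]) auto
    ultimately show "(\<Sum>l<k. N i l * A $$ (l,j)) = c * N i j - (if i = j then 1 else 0)"
      by (simp add: algebra_simps)
  qed
qed

context idempotent_system
begin

definition rep_mat :: "'a rep \<Rightarrow> 'a \<Rightarrow> complex mat" where
  "rep_mat ts z = mat (length ts) (length ts)
     (\<lambda>(i,j). entry (fst (snd (ts ! i))) (fst (snd (ts ! j))) (snd (snd (ts ! i)) * z * fst (ts ! j)))"

lemma valid_nth: "valid ts \<Longrightarrow> i < length ts \<Longrightarrow> fst (snd (ts ! i)) \<in> P"
  unfolding valid_def case_prod_unfold by simp

lemma rep_mat_carrier: "rep_mat ts z \<in> carrier_mat (length ts) (length ts)"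
  by (simp add: rep_mat_def)

lemma rep_trace_rep_mat: "rep_trace (\<lambda>_. 1) ts = (\<Sum>i<length ts. rep_mat ts 1 $$ (i,i))"
  by (simp add: rep_trace_def rep_mat_def sum_list_sum_nth atLeast0LessThan case_prod_unfold)

text \<open>
  With the row \<open>u\<close> of the \<open>x p\<close> and the column \<open>v\<close> of the \<open>p y\<close>, this compares the products
  \<open>(z u) v\<close> and \<open>v (z u)\<close>.
\<close>

lemma spectrum_rep_mat:
  assumes ts: "valid ts" and c: "c \<noteq> 0"
  shows "c \<in> spectrum (z * val ts) \<longleftrightarrow> poly (char_poly (rep_mat ts z)) c = 0"
proof -
  define k where "k = length ts"
  define x p y where "x i = fst (ts ! i)" and "p i = fst (snd (ts ! i))" and "y i = snd (snd (ts ! i))" for i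
  define M where "M i j = rep_mat ts z $$ (i,j)" for i j
  have P: "p i \<in> P" if "i < k" for i
    using valid_nth[OF ts] that by (simp add: p_def k_def)
  have pp: "p i * p i = p i" if "i < k" for i using P_idem[OF P[OF that]] .
  have a: "val ts = (\<Sum>i<k. x i * p i * y i)"
    by (simp add: val_def k_def x_def p_def y_def sum_list_sum_nth atLeast0LessThan case_prod_unfold)
  have Ml: "p i * (y i * z * x j) * p j = M i j *\<^sub>C p i" if "i < k" "j < k" for i j
    using that by (simp add: entry_left P M_def rep_mat_def x_def p_def y_def flip: k_def)
      (simp add: entry_left P flip: p_def)
  have Mr: "p i * (y i * z * x j) * p j = M i j *\<^sub>C p j" if "i < k" "j < k" for i j
    using that by (simp add: M_def rep_mat_def x_def y_def flip: k_def)
      (simp add: entry_right P flip: p_def)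
  have C: "rep_mat ts z \<in> carrier_mat k k" unfolding k_def by (rule rep_mat_carrier)
  show ?thesis
  proof
    assume "poly (char_poly (rep_mat ts z)) c = 0"
    then have "eigenvalue (rep_mat ts z) c" using eigenvalue_root_char_poly[OF C] by simp
    then obtain v where v: "v \<in> carrier_vec k" "v \<noteq> 0\<^sub>v k" "rep_mat ts z *\<^sub>v v = c \<cdot>\<^sub>v v"
      using C unfolding eigenvalue_def eigenvector_def by auto
    define b where "b i = vec_index v i" for i
    have ev: "(\<Sum>j<k. M i j * b j) = c * b i" if "i < k" for i
    proof -
      have "vec_index (rep_mat ts z *\<^sub>v v) i = (\<Sum>j<k. M i j * b j)"
        using C v(1) that by (auto simp: scalar_prod_def M_def b_def atLeast0LessThan)
      then show ?thesis using v that by (simp add: b_def)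
    qed
    \<comment> \<open>The eigenvector \<open>b\<close> is lifted along the row of the
      \<open>z * x j * p j\<close>. The next fact recovers \<open>c * b i\<close> from
      \<open>u\<close>, so \<open>u\<close> is nonzero because \<open>c\<close> is.\<close>
    define u where "u = (\<Sum>j<k. b j *\<^sub>C (z * x j * p j))"
    have pyu: "p i * y i * u = (c * b i) *\<^sub>C p i" if i: "i < k" for i
    proof -
      have "p i * y i * u = (\<Sum>j<k. b j *\<^sub>C (p i * (y i * z * x j) * p j))"
        by (simp add: u_def sum_distrib_left mult_scaleC_right mult.assoc)
      also have "\<dots> = (\<Sum>j<k. M i j * b j) *\<^sub>C p i"
        using i by (simp add: Ml scaleC_scaleC mult.commute complex_vector.scale_sum_left)
      finally show ?thesis using ev[OF i] by simp
    qed
    have zau: "z * val ts * u = c *\<^sub>C u"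
    proof -
      have "z * val ts * u = (\<Sum>i<k. z * x i * (p i * y i * u))"
        by (simp add: a sum_distrib_left sum_distrib_right mult.assoc)
      also have "\<dots> = (\<Sum>i<k. c *\<^sub>C (b i *\<^sub>C (z * x i * p i)))"
        by (intro sum.cong refl) (simp add: pyu mult_scaleC_right scaleC_scaleC)
      finally show ?thesis by (simp add: u_def complex_vector.scale_sum_right)
    qed
    have "u \<noteq> 0"
    proof
      assume "u = 0"
      then have "(c * b i) *\<^sub>C p i = 0" if "i < k" for i using pyu[OF that] by simp
      then have "b i = 0" if "i < k" for i using c P_nonzero[OF P] that by fastforce
      then have "v = 0\<^sub>v k" using v(1) by (intro eq_vecI) (auto simp: b_def)
      then show False using v(2) by simp
    qed
    show "c \<in> spectrum (z * val ts)"
    proof (rule ccontr)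
      assume "c \<notin> spectrum (z * val ts)"
      then obtain w where "w * (c *\<^sub>C 1 - z * val ts) = 1" unfolding spectrum_def by blast
      then have "u = w * ((c *\<^sub>C 1 - z * val ts) * u)" by (simp flip: mult.assoc)
      also have "\<dots> = 0" using zau by (simp add: left_diff_distrib mult_scaleC_left)
      finally show False using \<open>u \<noteq> 0\<close> by simp
    qed
  next
    assume sp: "c \<in> spectrum (z * val ts)"
    show "poly (char_poly (rep_mat ts z)) c = 0"
    proof (rule ccontr)
      assume "poly (char_poly (rep_mat ts z)) c \<noteq> 0"
      from char_matrix_inverse[OF C this]
      obtain N where N: "\<forall>i<k. \<forall>j<k.
          (\<Sum>l<k. M i l * N l j) = c * N i j - (if i = j then 1 else 0) \<and>
          (\<Sum>l<k. N i l * M l j) = c * N i j - (if i = j then 1 else 0)"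
        unfolding M_def by (rule exE)
      note N1 = N[rule_format, THEN conjunct1] and N2 = N[rule_format, THEN conjunct2]
      define E where "E i j = z * x i * p i * p j * y j" for i j
      \<comment> \<open>\<open>S\<close> is the row of the \<open>z * x i * p i\<close> times
        \<open>N\<close> times the column of the \<open>p j * y j\<close>. The inverse of
        \<open>c 1 - z * val ts\<close> is \<open>(1 + S) / c\<close>, as in the passage from an
        inverse of \<open>1 - a b\<close> to one of \<open>1 - b a\<close>.\<close>
      define S where "S = (\<Sum>i<k. \<Sum>j<k. N i j *\<^sub>C E i j)"
      have za: "z * val ts = (\<Sum>i<k. E i i)"
        unfolding a sum_distrib_left E_def using pp by (intro sum.cong refl) (metis lessThan_iff mult.assoc)
      have E1: "E i i * E l j = M i l *\<^sub>C E i j" if "i < k" "l < k" "j < k" for i l j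
      proof -
        have "E i i * E l j = z * x i * p i * (p i * (y i * z * x l) * p l) * p j * y j"
          by (simp add: E_def mult.assoc)
        also have "\<dots> = M i l *\<^sub>C (z * x i * (p i * p i) * p j * y j)"
          unfolding Ml[OF that(1,2)] by (simp add: mult_scaleC_left mult_scaleC_right mult.assoc)
        finally show ?thesis using that pp by (simp add: E_def)
      qed
      have E2: "E l j * E i i = M j i *\<^sub>C E l i" if "i < k" "l < k" "j < k" for i l j
      proof -
        have "E l j * E i i = z * x l * p l * (p j * (y j * z * x i) * p i) * p i * y i"
          by (simp add: E_def mult.assoc)
        also have "\<dots> = M j i *\<^sub>C (z * x l * p l * (p i * p i) * y i)"
          unfolding Mr[OF that(3,1)] by (simp add: mult_scaleC_left mult_scaleC_right mult.assoc)
        finally show ?thesis using that pp by (simp add: E_def)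
      qed
      have delta: "(\<Sum>i<k. \<Sum>j<k. (c * N i j - (if i = j then 1 else 0)) *\<^sub>C E i j) = c *\<^sub>C S - z * val ts"
      proof -
        have "(\<Sum>j<k. (if i = j then 1 else 0) *\<^sub>C E i j) = E i i" if "i < k" for i
          using that by (subst sum.cong[OF refl, of _ _ "\<lambda>j. if i = j then E i j else 0"]) auto
        then show ?thesis
          by (simp add: za S_def complex_vector.scale_left_diff_distrib sum_subtractf
              complex_vector.scale_sum_right scaleC_scaleC)
      qed
      have zaS: "z * val ts * S = c *\<^sub>C S - z * val ts"
      proof -
        have "z * val ts * S = (\<Sum>i<k. E i i * S)" by (simp only: za sum_distrib_right)
        also have "\<dots> = (\<Sum>i<k. \<Sum>l<k. \<Sum>j<k. N l j *\<^sub>C (E i i * E l j))"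
          by (simp add: S_def sum_distrib_left mult_scaleC_right)
        also have "\<dots> = (\<Sum>i<k. \<Sum>l<k. \<Sum>j<k. (M i l * N l j) *\<^sub>C E i j)"
          by (intro sum.cong refl) (simp add: E1 scaleC_scaleC mult.commute)
        also have "\<dots> = (\<Sum>i<k. \<Sum>j<k. \<Sum>l<k. (M i l * N l j) *\<^sub>C E i j)"
          by (intro sum.cong refl sum.swap)
        also have "\<dots> = (\<Sum>i<k. \<Sum>j<k. (c * N i j - (if i = j then 1 else 0)) *\<^sub>C E i j)"
          by (intro sum.cong refl) (simp add: N1 flip: complex_vector.scale_sum_left)
        finally show ?thesis using delta by simp
      qed
      have Sza: "S * (z * val ts) = c *\<^sub>C S - z * val ts"
      proof -
        have "S * (z * val ts) = (\<Sum>l<k. \<Sum>j<k. N l j *\<^sub>C (E l j * (z * val ts)))"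
          by (simp only: S_def sum_distrib_right mult_scaleC_left)
        also have "\<dots> = (\<Sum>l<k. \<Sum>j<k. \<Sum>i<k. N l j *\<^sub>C (E l j * E i i))"
          by (simp add: za sum_distrib_left complex_vector.scale_sum_right)
        also have "\<dots> = (\<Sum>l<k. \<Sum>j<k. \<Sum>i<k. (N l j * M j i) *\<^sub>C E l i)"
          by (intro sum.cong refl) (simp add: E2 scaleC_scaleC)
        also have "\<dots> = (\<Sum>l<k. \<Sum>i<k. \<Sum>j<k. (N l j * M j i) *\<^sub>C E l i)"
          by (intro sum.cong refl sum.swap)
        also have "\<dots> = (\<Sum>l<k. \<Sum>i<k. (c * N l i - (if l = i then 1 else 0)) *\<^sub>C E l i)"
          by (intro sum.cong refl) (simp add: N2 flip: complex_vector.scale_sum_left)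
        finally show ?thesis using delta by simp
      qed
      have "c \<notin> spectrum (z * val ts)"
      proof (rule notin_spectrumI)
        show "inverse c *\<^sub>C (1 + S) * (c *\<^sub>C 1 - z * val ts) = 1"
          using c Sza by (simp add: distrib_right right_diff_distrib mult_scaleC_left mult_scaleC_right
              complex_vector.scale_right_diff_distrib scaleC_add_right)
        show "(c *\<^sub>C 1 - z * val ts) * (inverse c *\<^sub>C (1 + S)) = 1"
          using c zaS by (simp add: distrib_left left_diff_distrib mult_scaleC_left mult_scaleC_right
              complex_vector.scale_right_diff_distrib scaleC_add_right)
      qed
      then show False using sp by simp
    qed
  qed
qed

section \<open>The socle and its rank described by formal sums\<close>

lemma nonzero_spectrum_rep_mat:
  "valid ts \<Longrightarrow> nonzero_spectrum (z * val ts) = {c. poly (char_poly (rep_mat ts z)) c = 0} - {0}"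
  using spectrum_rep_mat unfolding nonzero_spectrum_def by blast

lemma char_poly_rep_mat_roots:
  "finite {c. poly (char_poly (rep_mat ts z)) c = 0}"
  "card {c. poly (char_poly (rep_mat ts z)) c = 0} \<le> length ts"
proof -
  have d: "degree (char_poly (rep_mat ts z)) = length ts" "char_poly (rep_mat ts z) \<noteq> 0"
    using degree_monic_char_poly[OF rep_mat_carrier[of ts z]] by auto
  show "finite {c. poly (char_poly (rep_mat ts z)) c = 0}" by (rule poly_roots_finite[OF d(2)])
  show "card {c. poly (char_poly (rep_mat ts z)) c = 0} \<le> length ts"
    using poly_roots_degree[OF d(2)] d(1) by simp
qed

lemma ecard_nonzero_spectrum_val:
  assumes "valid ts"
  shows "ecard (nonzero_spectrum (z * val ts)) = enat (card ({c. poly (char_poly (rep_mat ts z)) c = 0} - {0}))"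
    "ecard (nonzero_spectrum (z * val ts)) \<le> enat (length ts)"
proof -
  show 1: "ecard (nonzero_spectrum (z * val ts)) = enat (card ({c. poly (char_poly (rep_mat ts z)) c = 0} - {0}))"
    unfolding nonzero_spectrum_rep_mat[OF assms] using char_poly_rep_mat_roots(1) by (simp add: ecard_def)
  show "ecard (nonzero_spectrum (z * val ts)) \<le> enat (length ts)"
    unfolding 1 enat_ord_simps
    by (rule order_trans[OF card_mono char_poly_rep_mat_roots(2)[of ts z]]) (use char_poly_rep_mat_roots(1) in auto)
qed

lemma spectral_rank_val_le: "valid ts \<Longrightarrow> spectral_rank (val ts) \<le> enat (length ts)"
  unfolding spectral_rank_def by (intro SUP_least ecard_nonzero_spectrum_val)

lemma val_in_Soc: "valid ts \<Longrightarrow> val ts \<in> Soc"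
  unfolding Soc_def by (rule CollectI, rule le_less_trans[OF spectral_rank_val_le]) simp_all

lemma Soc_iff_rep: "a \<in> Soc \<longleftrightarrow> (\<exists>ts. valid ts \<and> val ts = a)"
  using Soc_rep val_in_Soc by metis

text \<open>Closure under addition is not visible from the rank; for formal sums it is
  concatenation.\<close>

lemma Soc_two_sided_ideal: "two_sided_ideal (Soc :: 'a set)"
  unfolding two_sided_ideal_def complex_vector.subspace_def
proof (intro conjI allI ballI)
  show "0 \<in> (Soc :: 'a set)" using val_in_Soc[of "[]"] by simp
  fix a :: 'a assume "a \<in> Soc"
  then obtain ts where ts: "valid ts" "val ts = a" using Soc_rep by metis
  show "c *\<^sub>C a \<in> Soc" for c
    using rep_scaleC[OF ts(1), of c] ts(2) unfolding Soc_iff_rep by blast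
  show "b * a \<in> Soc" "a * b \<in> Soc" for b
    using rep_mult[OF ts(1), of b] ts(2) unfolding Soc_iff_rep by metis+
  fix b :: 'a assume "b \<in> Soc"
  then obtain us where "valid us" "val us = b" using Soc_rep by metis
  then show "a + b \<in> Soc" using val_in_Soc[of "ts @ us"] ts by simp
qed

lemma weighted_trace_linear: "linear_functional_on Soc (weighted_trace w)"
  unfolding linear_functional_on_def
proof (intro conjI allI ballI)
  fix a :: 'a assume "a \<in> Soc"
  then obtain ts where ts: "valid ts" "val ts = a" using Soc_rep by metis
  show "weighted_trace w (c *\<^sub>C a) = c * weighted_trace w a" for c
    using rep_scaleC[OF ts(1), of c w] ts weighted_trace_val by metis
  fix b :: 'a assume "b \<in> Soc"
  then obtain us where us: "valid us" "val us = b" using Soc_rep by metis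
  show "weighted_trace w (a + b) = weighted_trace w a + weighted_trace w b"
    using weighted_trace_val[of "ts @ us" w] weighted_trace_val[of ts w] weighted_trace_val[of us w] ts us
    by simp
qed

lemma weighted_trace_comm:
  assumes "a \<in> Soc"
  shows "weighted_trace w (a * b) = weighted_trace w (b * a)"
proof -
  obtain ts where "valid ts" "val ts = a" using Soc_rep assms by metis
  then show ?thesis using rep_mult[of ts b w] weighted_trace_val by metis
qed

text \<open>Some \<open>z\<close> attains the rank. The matrix is affine along the line from
  \<open>1\<close> to \<open>z\<close>, so all but finitely many parameters attain it too, among
  them arbitrarily small positive ones.\<close>

lemma rank_attaining_dense:
  assumes ts: "valid ts" "enat (length ts) \<le> spectral_rank (val ts)" and e: "\<epsilon> > 0"
  shows "rank_attaining (val ts) \<inter> ball 1 \<epsilon> \<noteq> {}"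
proof -
  let ?k = "length ts"
  define n where "n z = card ({c. poly (char_poly (rep_mat ts z)) c = 0} - {0})" for z
  have n: "ecard (nonzero_spectrum (z * val ts)) = enat (n z)" "n z \<le> ?k" for z
    using ecard_nonzero_spectrum_val[OF ts(1), of z] unfolding n_def by auto
  have rank: "spectral_rank (val ts) = enat ?k"
    using spectral_rank_val_le[OF ts(1)] ts(2) by (rule antisym)
  have att: "z \<in> rank_attaining (val ts) \<longleftrightarrow> n z = ?k" for z
    by (simp add: rank_attaining_def n rank)
  have "\<exists>z. n z = ?k"
  proof (rule ccontr)
    assume "\<not> ?thesis"
    then have lt: "n z < ?k" for z using n(2)[of z] by (metis le_neq_implies_less)
    then have "spectral_rank (val ts) \<le> enat (?k - 1)"
      unfolding spectral_rank_def n by (intro SUP_least) (metis Suc_pred' enat_ord_simps(1) less_Suc_eq_le gr_zeroI not_less_zero)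
    then show False using rank lt[of 0] by simp
  qed
  then obtain z where z: "n z = ?k" by blast
  define path where "path s = 1 + s *\<^sub>C (z - 1)" for s
  define p where "p i = fst (snd (ts ! i))" for i
  define A where "A i j = entry (p i) (p j) (snd (snd (ts ! i)) * fst (ts ! j))" for i j
  define D where "D i j = entry (p i) (p j) (snd (snd (ts ! i)) * (z - 1) * fst (ts ! j))" for i j
  have P: "p i \<in> P" if "i < ?k" for i using valid_nth[OF ts(1) that] by (simp add: p_def)
  have M: "rep_mat ts (path s) = mat ?k ?k (\<lambda>(i,j). A i j + s * D i j)" for s
    by (rule eq_matI) (auto simp: rep_mat_def path_def A_def D_def distrib_left distrib_right
        mult_scaleC_left mult_scaleC_right entry_add entry_scaleC P simp flip: p_def)
  have "n (path 1) = ?k" using z by (simp add: path_def)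
  then have fin: "finite {s. n (path s) \<noteq> ?k}"
    unfolding n_def M by (rule finite_nonsimple_parameters)
  define \<delta> where "\<delta> = \<epsilon> / (norm (z - 1) + 1)"
  have pos: "norm (z - 1) + 1 > 0" by (simp add: add_nonneg_pos)
  then have "\<delta> > 0" using e by (simp add: \<delta>_def)
  then have "infinite (complex_of_real ` {0<..<\<delta>})"
    by (subst finite_image_iff) (auto simp: inj_on_def)
  then have "\<not> complex_of_real ` {0<..<\<delta>} \<subseteq> {s. n (path s) \<noteq> ?k}"
    using finite_subset[OF _ fin] by auto
  then obtain s where s: "s \<in> {0<..<\<delta>}" "n (path (complex_of_real s)) = ?k"
    unfolding image_subset_iff mem_Collect_eq by metis
  have "s * norm (z - 1) < \<epsilon>"
  proof -
    have "s * norm (z - 1) \<le> s * (norm (z - 1) + 1)" using s by (intro mult_left_mono) auto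
    also have "\<dots> < \<delta> * (norm (z - 1) + 1)" using s pos by (intro mult_strict_right_mono) auto
    finally show ?thesis using pos by (simp add: \<delta>_def)
  qed
  then have "path (complex_of_real s) \<in> ball 1 \<epsilon>"
    using s by (simp add: path_def dist_norm norm_scaleC)
  then show ?thesis using s(2) att by blast
qed

text \<open>At an \<open>x\<close> that attains the rank all roots are simple and nonzero, so points
  of the spectrum in the disk are counted like roots. As \<open>x\<close> tends to \<open>1\<close>,
  the roots in the disk merge into \<open>\<mu>\<close>.\<close>

lemma multiplicity_at_val:
  assumes ts: "valid ts" "enat (length ts) \<le> spectral_rank (val ts)"
    and \<mu>: "\<mu> \<in> spectrum (val ts)" "\<mu> \<noteq> 0"
  shows "multiplicity_at \<mu> (val ts) = Polynomial.order \<mu> (char_poly (rep_mat ts 1))"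
proof -
  let ?k = "length ts" and ?a = "val ts"
  define roots where "roots z = {c. poly (char_poly (rep_mat ts z)) c = 0}" for z
  have rank: "spectral_rank ?a = enat ?k"
    using spectral_rank_val_le[OF ts(1)] ts(2) by (rule antisym)
  have sp: "spectrum (z * ?a) - {0} = roots z - {0}" for z
    using nonzero_spectrum_rep_mat[OF ts(1), of z] by (simp add: nonzero_spectrum_def roots_def)
  have fin: "finite (roots z)" "card (roots z) \<le> ?k" for z
    using char_poly_rep_mat_roots[of ts z] by (simp_all add: roots_def)
  \<comment> \<open>Including 0 keeps it out of the disk, inside which spectrum and roots then
    coincide.\<close>
  have "finite (insert 0 (roots 1) - {\<mu>})" using fin by simp
  then obtain d where d: "d > 0" "\<And>c. c \<in> insert 0 (roots 1) \<Longrightarrow> c \<noteq> \<mu> \<Longrightarrow> d \<le> dist \<mu> c"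
    using finite_set_avoid[of "insert 0 (roots 1) - {\<mu>}" \<mu>] by auto
  define r where "r = d / 2"
  have r: "r > 0" and iso: "\<And>c. c \<in> insert 0 (roots 1) \<Longrightarrow> c \<in> cball \<mu> r \<Longrightarrow> c = \<mu>"
    using d by (force simp: r_def)+
  have r0: "0 \<notin> cball \<mu> r" using iso[of 0] \<mu>(2) by auto
  have "\<exists>\<epsilon>>0. \<forall>x. x \<in> rank_attaining ?a \<longrightarrow> x \<in> ball 1 \<epsilon> \<longrightarrow>
      ecard (spectrum (x * ?a) \<inter> ball \<mu> r) = enat (Polynomial.order \<mu> (char_poly (rep_mat ts 1)))"
  proof (rule ccontr)
    assume neg: "\<not> ?thesis"
    have "\<exists>x. x \<in> rank_attaining ?a \<and> x \<in> ball 1 (inverse (real (Suc n))) \<and>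
      ecard (spectrum (x * ?a) \<inter> ball \<mu> r) \<noteq> enat (Polynomial.order \<mu> (char_poly (rep_mat ts 1)))" for n
    proof -
      have "inverse (real (Suc n)) > 0" by simp
      with neg show ?thesis by blast
    qed
    then obtain X where X: "\<And>n. X n \<in> rank_attaining ?a" "\<And>n. X n \<in> ball 1 (inverse (real (Suc n)))"
      "\<And>n. ecard (spectrum (X n * ?a) \<inter> ball \<mu> r) \<noteq> enat (Polynomial.order \<mu> (char_poly (rep_mat ts 1)))"
      by metis
    have Xlim: "X \<longlonglongrightarrow> 1"
      using X(2) by (intro metric_tendsto_imp_tendsto[OF LIMSEQ_inverse_real_of_nat])
        (auto simp: dist_commute less_imp_le)
    have card0: "card (roots (X n) - {0}) = ?k" for n
      using X(1)[of n] ecard_nonzero_spectrum_val(1)[OF ts(1), of "X n"]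
      by (simp add: rank_attaining_def rank roots_def)
    have cardX: "card (roots (X n)) = ?k" for n
      using card0[of n] card_mono[of "roots (X n)" "roots (X n) - {0}"] fin[of "X n"] by simp
    have "\<exists>n. card {c. poly (char_poly (rep_mat ts (X n))) c = 0 \<and> c \<in> ball \<mu> r} =
        Polynomial.order \<mu> (char_poly (rep_mat ts 1))"
    proof (rule char_poly_root_count_limit[OF rep_mat_carrier rep_mat_carrier])
      fix i j assume ij: "i < ?k" "j < ?k"
      let ?y = "snd (snd (ts ! i))" and ?x = "fst (ts ! j)"
      have "(\<lambda>n. ?y * X n * ?x) \<longlonglongrightarrow> ?y * 1 * ?x" by (intro tendsto_intros Xlim)
      from tendsto_entry[OF valid_nth[OF ts(1) ij(1)] valid_nth[OF ts(1) ij(2)] this]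
      show "(\<lambda>n. rep_mat ts (X n) $$ (i,j)) \<longlonglongrightarrow> rep_mat ts 1 $$ (i,j)"
        using ij by (simp add: rep_mat_def)
    next
      fix n c assume "poly (char_poly (rep_mat ts (X n))) c = 0"
      then have "c = 0 \<or> c \<in> spectrum (X n * ?a)" using sp[of "X n"] by (auto simp: roots_def)
      then have "cmod c \<le> norm (X n * ?a)" using spectrum_norm_le[of c "X n * ?a"] by auto
      also have "\<dots> \<le> norm (X n) * norm ?a" by (rule norm_mult_ineq)
      also have "norm (X n) \<le> norm (1::'a) + 1"
      proof -
        have "norm (X n - 1) \<le> 1"
          using X(2)[of n] by (simp add: dist_norm norm_minus_commute)
            (smt (verit) inverse_le_1_iff of_nat_0_le_iff)
        then show ?thesis using norm_triangle_sub[of "X n" 1] by simp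
      qed
      finally show "cmod c \<le> (norm (1::'a) + 1) * norm ?a" by (simp add: mult_right_mono)
    next
      show "card {c. poly (char_poly (rep_mat ts (X n))) c = 0} = ?k" for n
        using cardX by (simp add: roots_def)
      show "c = \<mu>" if "poly (char_poly (rep_mat ts 1)) c = 0" "c \<in> cball \<mu> r" for c
        using iso that by (simp add: roots_def)
      show "r > 0" by (rule r)
    qed
    then obtain n where n: "card (roots (X n) \<inter> ball \<mu> r) = Polynomial.order \<mu> (char_poly (rep_mat ts 1))"
      unfolding roots_def by (auto simp: Int_def)
    have "0 \<notin> ball \<mu> r" using r0 ball_subset_cball by blast
    then have "spectrum (X n * ?a) \<inter> ball \<mu> r = roots (X n) \<inter> ball \<mu> r"
      using sp[of "X n"] by blast
    then show False using X(3)[of n] n fin(1)[of "X n"] by (simp add: ecard_def)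
  qed
  then obtain \<epsilon> where e: "\<epsilon> > 0" "\<And>x. x \<in> rank_attaining ?a \<Longrightarrow> x \<in> ball 1 \<epsilon> \<Longrightarrow>
      ecard (spectrum (x * ?a) \<inter> ball \<mu> r) = enat (Polynomial.order \<mu> (char_poly (rep_mat ts 1)))"
    by blast
  have "cball \<mu> r \<inter> spectrum ?a = {\<mu>}"
  proof (intro equalityI subsetI)
    fix c assume c: "c \<in> cball \<mu> r \<inter> spectrum ?a"
    then have "c \<in> spectrum (1 * ?a) - {0}" using r0 by auto
    then have "c \<in> roots 1" unfolding sp by blast
    then show "c \<in> {\<mu>}" using iso c by blast
  qed (use \<mu>(1) r in auto)
  from multiplicity_at_eqI[OF rank_attaining_dense[OF ts] r this e] show ?thesis .
qed

lemma Tr_eq_weighted_trace: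
  assumes "a \<in> Soc"
  shows "Tr a = weighted_trace (\<lambda>_. 1) a"
proof -
  obtain ts where ts: "valid ts" "val ts = a" "enat (length ts) \<le> spectral_rank a"
    using Soc_rep[OF assms] .
  let ?c = "char_poly (rep_mat ts 1)"
  have sp: "spectrum a - {0} = {c. poly ?c c = 0} - {0}"
    using nonzero_spectrum_rep_mat[OF ts(1), of 1] ts(2) by (simp add: nonzero_spectrum_def)
  have "finite (insert 0 {c. poly ?c c = 0})" using char_poly_rep_mat_roots(1) by simp
  then have fin: "finite (spectrum a)" by (rule rev_finite_subset) (use sp in blast)
  have "Tr a = (\<Sum>\<mu>\<in>spectrum a. \<mu> * of_nat (Polynomial.order \<mu> ?c))"
    unfolding Tr_def
  proof (intro sum.cong refl)
    fix \<mu> assume "\<mu> \<in> spectrum a"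
    \<comment> \<open>The multiplicity at 0 is never computed: its factor in the sum is 0.\<close>
    then show "\<mu> * of_nat (multiplicity_at \<mu> a) = \<mu> * of_nat (Polynomial.order \<mu> ?c)"
      using multiplicity_at_val[OF ts(1)] ts(2,3) by (cases "\<mu> = 0") auto
  qed
  also have "\<dots> = (\<Sum>i<length ts. rep_mat ts 1 $$ (i,i))"
    using sp by (intro sum_order_eq_trace rep_mat_carrier fin) auto
  also have "\<dots> = weighted_trace (\<lambda>_. 1) a"
    using weighted_trace_val[OF ts(1)] ts(2) by (simp add: rep_trace_rep_mat)
  finally show ?thesis .
qed

end

section \<open>Minimality of the socle\<close>

lemma two_sided_ideal_sum:
  "two_sided_ideal I \<Longrightarrow> (\<And>t. t \<in> set ts \<Longrightarrow> f t \<in> I) \<Longrightarrow> (\<Sum>t\<leftarrow>ts. f t) \<in> I"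
  by (induction ts)
    (simp_all add: two_sided_ideal_def complex_vector.subspace_0 complex_vector.subspace_add)

context idempotent_system
begin

lemma P_subset_Soc: "p \<in> P \<Longrightarrow> p \<in> Soc"
  using val_in_Soc[of "[(1, p, 1)]"] by simp

lemma weighted_trace_P: "p \<in> P \<Longrightarrow> weighted_trace w p = w p"
  using weighted_trace_val[of "[(1, p, 1)]" w] entry_eqI[of p 1 1] P_idem by simp

text \<open>If all \<open>p * z * a\<close> vanished for the \<open>p\<close> occurring in
  \<open>a\<close>, then \<open>a A a\<close> would be zero. Otherwise semiprimeness provides a
  nonzero \<open>p * (z * a * b) * p\<close>, a multiple of \<open>p\<close> inside
  \<open>I\<close>.\<close>

lemma ideal_meets_P:
  assumes I: "two_sided_ideal I" "I \<subseteq> Soc" and a: "a \<in> I" "a \<noteq> 0"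
  obtains p where "p \<in> P" "p \<in> I"
proof -
  obtain ts where ts: "valid ts" "val ts = a" using I a Soc_rep by blast
  have "\<exists>(x, p, y)\<in>set ts. \<exists>z. p * z * a \<noteq> 0"
  proof (rule ccontr)
    assume "\<not> ?thesis"
    then have z: "p * z * a = 0" if "(x, p, y) \<in> set ts" for x p y z using that by blast
    obtain b where b: "a * b * a \<noteq> 0" using semiprime[OF ss a(2)] .
    have "val ts * b * a = (\<Sum>(x, p, y)\<leftarrow>ts. x * (p * (y * b) * a))"
      by (induction ts) (auto simp: distrib_right mult.assoc)
    also have "\<dots> = (\<Sum>t\<leftarrow>ts. 0)" using z by (intro arg_cong[of _ _ sum_list] map_cong) auto
    finally show False using b ts(2) by simp
  qed
  then obtain p z where p: "p \<in> P" "p * z * a \<noteq> 0" using ts(1) unfolding valid_def by blast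
  then obtain b where "p * z * a * b * (p * z * a) \<noteq> 0" using semiprime[OF ss] by blast
  moreover have "p * z * a * b * (p * z * a) = (p * (z * a * b) * p) * z * a" by (simp add: mult.assoc)
  moreover have e: "p * (z * a * b) * p = entry p p (z * a * b) *\<^sub>C p" using entry_left p(1) by blast
  ultimately have c: "entry p p (z * a * b) \<noteq> 0" by auto
  have "p * (z * a * b) * p \<in> I" using I(1) a(1) by (simp add: two_sided_ideal_def)
  then have "inverse (entry p p (z * a * b)) *\<^sub>C (p * (z * a * b) * p) \<in> I"
    using I(1) complex_vector.subspace_scale unfolding two_sided_ideal_def by blast
  then have "p \<in> I" unfolding e using c by (simp add: scaleC_scaleC)
  then show ?thesis using that p(1) by blast
qed

lemma Soc_subset_ideal:
  assumes I: "two_sided_ideal I" and P: "P \<subseteq> I"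
  shows "Soc \<subseteq> I"
proof
  fix a :: 'a assume "a \<in> Soc"
  then obtain ts where ts: "valid ts" "val ts = a" using Soc_rep by metis
  have "(\<Sum>t\<leftarrow>ts. (\<lambda>(x, p, y). x * p * y) t) \<in> I"
    using ts(1) P I by (intro two_sided_ideal_sum[OF I]) (auto simp: valid_def two_sided_ideal_def)
  then show "a \<in> I" using ts(2) by (simp add: val_def)
qed

lemma functional_zero: "linear_functional_on Soc f \<Longrightarrow> f (0::'a) = 0"
  using complex_vector.subspace_0[of "Soc :: 'a set"] Soc_two_sided_ideal
  unfolding linear_functional_on_def two_sided_ideal_def
  by (metis complex_vector.scale_zero_left mult_zero_left)

text \<open>For distinct \<open>p\<close> and \<open>q\<close>, the socle elements annihilated by
  \<open>p A\<close> form an ideal containing \<open>q\<close> but not \<open>p\<close>.\<close>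

lemma minimal_Soc_P_subsingleton:
  assumes "minimal_two_sided_ideal (Soc :: 'a set)" "p \<in> P" "q \<in> P"
  shows "p = q"
proof (rule ccontr)
  assume ne: "p \<noteq> q"
  define I where "I = {a \<in> Soc. \<forall>x. p * x * a = 0}"
  have S: "two_sided_ideal (Soc :: 'a set)" by (rule Soc_two_sided_ideal)
  have "two_sided_ideal I"
    unfolding two_sided_ideal_def complex_vector.subspace_def
  proof (intro conjI allI ballI)
    note S' = S[unfolded two_sided_ideal_def complex_vector.subspace_def]
    show "0 \<in> I" using S' by (simp add: I_def)
    fix a assume a: "a \<in> I"
    then have az: "p * x * a = 0" and aS: "a \<in> Soc" for x by (auto simp: I_def)
    show "c *\<^sub>C a \<in> I" for c using az aS S' by (simp add: I_def mult_scaleC_right)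
    show "b * a \<in> I" for b
    proof -
      have "p * x * (b * a) = 0" for x using az[of "x * b"] by (simp add: mult.assoc)
      then show ?thesis using aS S' by (simp add: I_def)
    qed
    show "a * b \<in> I" for b
    proof -
      have "p * x * (a * b) = 0" for x using az[of x] by (simp flip: mult.assoc)
      then show ?thesis using aS S' by (simp add: I_def)
    qed
    fix b assume "b \<in> I"
    then show "a + b \<in> I" using az aS S' by (simp add: I_def distrib_left)
  qed
  moreover have "I \<subseteq> Soc" by (auto simp: I_def)
  moreover have "q \<in> I" using orthogonal assms ne P_subset_Soc by (simp add: I_def)
  moreover have "p \<notin> I"
    using P_idem[OF assms(2)] P_nonzero[OF assms(2)] by (auto simp: I_def intro!: exI[of _ 1])
  ultimately show False
    using assms(1) P_subset_Soc[OF assms(2)] P_nonzero[OF assms(3)] unfolding minimal_two_sided_ideal_def by blast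
qed

text \<open>Splitting \<open>x * p * y\<close> as \<open>(x * p) * (p * y)\<close> and commuting the
  factors, both in the socle, gives a multiple of \<open>p\<close>. So \<open>f\<close> is
  determined by \<open>f p\<close>.\<close>

lemma tracial_functional_P:
  assumes f: "linear_functional_on Soc f" and tr: "\<And>a b. a \<in> Soc \<Longrightarrow> b \<in> Soc \<Longrightarrow> f (a * b) = f (b * a)"
    and P: "P \<subseteq> {p}" and a: "(a::'a) \<in> Soc"
  shows "f a = f p * Tr a"
proof -
  have "val ts \<in> Soc \<and> f (val ts) = f p * rep_trace (\<lambda>_. 1) ts" if "valid ts" for ts
    using that
  proof (induction ts)
    case Nil
    then show ?case using functional_zero[OF f] val_in_Soc[of "[]"] by simp
  next
    case (Cons t ts)
    obtain x q y where t: "t = (x, q, y)" by (cases t)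
    then have p: "p \<in> P" and q: "q = p" using Cons.prems P by auto
    have "x * p \<in> Soc" "p * y \<in> Soc" "x * p * y \<in> Soc"
      using val_in_Soc[of "[(x, p, 1)]"] val_in_Soc[of "[(1, p, y)]"] val_in_Soc[of "[(x, p, y)]"] p by simp_all
    then have "f ((x * p) * (p * y)) = f ((p * y) * (x * p))" using tr by blast
    moreover have "(x * p) * (p * y) = x * p * y" using P_idem[OF p] by (metis mult.assoc)
    moreover have "(p * y) * (x * p) = entry p p (y * x) *\<^sub>C p"
      using entry_left[OF p p, of "y * x"] by (simp add: mult.assoc)
    ultimately have "f (x * p * y) = entry p p (y * x) * f p"
      using f P_subset_Soc[OF p] by (simp add: linear_functional_on_def)
    moreover have "val ts \<in> Soc" "f (val ts) = f p * rep_trace (\<lambda>_. 1) ts"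
      using Cons t by auto
    ultimately show ?case
      using f \<open>x * p * y \<in> Soc\<close> val_in_Soc[OF Cons.prems] unfolding t q linear_functional_on_def
      by (simp add: algebra_simps)
  qed
  then show ?thesis using Soc_rep[OF a] Tr_eq_weighted_trace[OF a] weighted_trace_val by metis
qed

lemma scalar_trace_characterization_iff:
  "(\<forall>f :: 'a \<Rightarrow> complex. linear_functional_on Soc f \<longrightarrow>
      ((\<exists>\<alpha>. \<forall>a\<in>Soc. f a = \<alpha> * Tr a) \<longleftrightarrow> (\<forall>a\<in>Soc. \<forall>b\<in>Soc. f (a * b) = f (b * a))))
   \<longleftrightarrow> minimal_two_sided_ideal (Soc :: 'a set)"
  (is "?I \<longleftrightarrow> ?II")
proof
  assume I: ?I
  have P1: "p = q" if pq: "p \<in> P" "q \<in> P" for p q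
  proof (rule ccontr)
    assume ne: "p \<noteq> q"
    \<comment> \<open>This trace is 1 at \<open>p\<close> and 0 at \<open>q\<close>, whereas
      \<open>Tr\<close> is 1 at both.\<close>
    let ?f = "weighted_trace (\<lambda>r. if r = p then 1 else 0)"
    have "\<exists>\<alpha>. \<forall>a\<in>Soc. ?f a = \<alpha> * Tr a"
      using I weighted_trace_linear weighted_trace_comm by blast
    then obtain \<alpha> where \<alpha>: "\<And>a. a \<in> Soc \<Longrightarrow> ?f a = \<alpha> * weighted_trace (\<lambda>_. 1) a"
      using Tr_eq_weighted_trace by metis
    show False
      using \<alpha>[OF P_subset_Soc[OF pq(1)]] \<alpha>[OF P_subset_Soc[OF pq(2)]] ne pq by (simp add: weighted_trace_P)
  qed
  have "J = {0} \<or> J = Soc" if J: "two_sided_ideal J" "J \<subseteq> Soc" for J :: "'a set"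
  proof (cases "J \<subseteq> {0}")
    case True
    then show ?thesis using J(1) complex_vector.subspace_0 unfolding two_sided_ideal_def by blast
  next
    case False
    then obtain a where "a \<in> J" "a \<noteq> 0" by blast
    then obtain p where "p \<in> P" "p \<in> J" using ideal_meets_P[OF J] by blast
    then have "P \<subseteq> J" using P1 by blast
    then show ?thesis using Soc_subset_ideal[OF J(1)] J(2) by blast
  qed
  then show ?II using Soc_two_sided_ideal unfolding minimal_two_sided_ideal_def by blast
next
  assume II: ?II
  \<comment> \<open>An empty \<open>P\<close> is included: then the socle is zero and any
    \<open>p\<close> will do.\<close>
  obtain p where P: "P \<subseteq> {p}" using minimal_Soc_P_subsingleton[OF II] by blast
  show ?I
  proof (intro allI impI iffI)
    fix f :: "'a \<Rightarrow> complex" assume f: "linear_functional_on Soc f"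
    show "\<forall>a\<in>Soc. \<forall>b\<in>Soc. f (a * b) = f (b * a)" if "\<exists>\<alpha>. \<forall>a\<in>Soc. f a = \<alpha> * Tr a"
    proof (intro ballI)
      fix a b :: 'a assume ab: "a \<in> Soc" "b \<in> Soc"
      then have "a * b \<in> Soc" "b * a \<in> Soc" using Soc_two_sided_ideal by (auto simp: two_sided_ideal_def)
      then show "f (a * b) = f (b * a)"
        using that weighted_trace_comm[OF ab(1), of _ b] Tr_eq_weighted_trace by metis
    qed
    show "\<exists>\<alpha>. \<forall>a\<in>Soc. f a = \<alpha> * Tr a" if "\<forall>a\<in>Soc. \<forall>b\<in>Soc. f (a * b) = f (b * a)"
      using tracial_functional_P[OF f _ P] that by blast
  qed
qed

end

theorem theorem3p8:
  assumes "semisimple TYPE('a::complex_banach_algebra_1)"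
  shows "(\<forall>f :: 'a \<Rightarrow> complex. linear_functional_on Soc f \<longrightarrow>
            ((\<exists>\<alpha>. \<forall>a\<in>Soc. f a = \<alpha> * Tr a) \<longleftrightarrow>
             (\<forall>a\<in>Soc. \<forall>b\<in>Soc. f (a * b) = f (b * a))))
         \<longleftrightarrow> minimal_two_sided_ideal (Soc :: 'a set)"
proof -
  obtain P :: "'a set" where "idempotent_system P"
    using idempotent_system_exists[OF assms] .
  then interpret idempotent_system P .
  show ?thesis by (rule scalar_trace_characterization_iff)
qed

end
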